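(* Let $G$ be a chordal graph and let $\mathcal{F} = \mathcal{T} \cup \{K_5, K_4^-\}$. Then $G$ is a contact $B_0$-VPG graph if and only if $G$ is $\mathcal{F}$-free.
   Context: All graphs are finite and simple. A contact $B_0$-VPG representation of a graph $G$ assigns to each vertex $v$ a path $P_v$ on a rectangular grid such that: each $P_v$ is a horizontal or a vertical path on the grid (no bends) of length at least one (it contains at least one grid-edge); no two paths share a grid-edge; no two paths cross (no grid-point is an interior point of two distinct paths); and distinct vertices $u,v$ are adjacent if and only if $P_u$ and $P_v$ have at least one grid-point in common. A graph is contact $B_0$-VPG if it has such a representation. A graph is chordal if it has no induced cycle of length at least four. For a family $\mathcal{H}$ of graphs, $G$ is $\mathcal{H}$-free if no induced subgraph of $G$ is isomorphic to a member of $\mathcal{H}$. $K_4^-$ is $K_4$ minus one edge. $H_0$ is the graph composed of three copies of $K_4$ sharing one common vertex, with no further edges. $\mathcal{T}$ is the family containing $H_0$ and all graphs whose vertex set can be partitioned into a nontrivial tree $T_0$ (at least two vertices) of maximum degree at most three and a disjoint union of triangles, such that each triangle is complete to one vertex $v$ of $T_0$ and anticomplete to $T_0-\{v\}$, every leaf of $T_0$ is complete to exactly two of the triangles, every vertex of degree two in $T_0$ is complete to exactly one of the triangles, and vertices of degree three in $T_0$ have no neighbours outside $T_0$. (Complete/anticomplete: adjacent to all/none of the vertices.) *)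

theory Defs
  imports "HOL-Library.Ramsey"
begin

text \<open>
  From \<^theory>\<open>HOL-Library.Ramsey\<close> we use \<open>[A]\<^bsup>k\<^esup>\<close>, the set of all \<open>k\<close>-element subsets of \<open>A\<close>,
  and \<^const>\<open>clique\<close>. An edge is a two-element set of vertices.
\<close>

datatype 'a graph = Graph (verts: "'a set") (edges: "'a set set")

definition simple_graph :: "'a graph \<Rightarrow> bool" where
  "simple_graph G \<longleftrightarrow> finite (verts G) \<and> edges G \<subseteq> [verts G]\<^bsup>2\<^esup>"

definition adj :: "'a graph \<Rightarrow> 'a \<Rightarrow> 'a \<Rightarrow> bool" where
  "adj G u v \<longleftrightarrow> {u, v} \<in> edges G"

definition degree :: "'a graph \<Rightarrow> 'a \<Rightarrow> nat" where
  "degree G v = card {u \<in> verts G. adj G v u}"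

definition induced_subgraph :: "'a graph \<Rightarrow> 'a set \<Rightarrow> 'a graph" where
  "induced_subgraph G S = Graph (verts G \<inter> S) {e \<in> edges G. e \<subseteq> S}"

definition graph_iso :: "'a graph \<Rightarrow> 'b graph \<Rightarrow> bool" where
  "graph_iso G H \<longleftrightarrow> (\<exists>f. bij_betw f (verts G) (verts H) \<and>
     (\<forall>u \<in> verts G. \<forall>v \<in> verts G. adj G u v \<longleftrightarrow> adj H (f u) (f v)))"

definition has_induced :: "'a graph \<Rightarrow> 'b graph \<Rightarrow> bool" where
  "has_induced G H \<longleftrightarrow> (\<exists>S \<subseteq> verts G. graph_iso (induced_subgraph G S) H)"

definition free_of :: "'b graph set \<Rightarrow> 'a graph \<Rightarrow> bool" where
  "free_of \<H> G \<longleftrightarrow> (\<forall>H \<in> \<H>. \<not> has_induced G H)"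

text \<open>The cycle \<open>C\<^sub>n\<close>; only used for \<open>n \<ge> 3\<close>, where it is a simple graph.\<close>

definition cycle_graph :: "nat \<Rightarrow> nat graph" where
  "cycle_graph n = Graph {..<n} ((\<lambda>i. {i, Suc i mod n}) ` {..<n})"

definition complete_graph :: "nat \<Rightarrow> nat graph" where
  "complete_graph n = Graph {..<n} ([{..<n}]\<^bsup>2\<^esup>)"

definition K4_minus :: "nat graph" where
  "K4_minus = Graph {..<4} ([{..<4}]\<^bsup>2\<^esup> - {{0, 1}})"

definition chordal :: "'a graph \<Rightarrow> bool" where
  "chordal G \<longleftrightarrow> (\<forall>n \<ge> 4. \<not> has_induced G (cycle_graph n))"

definition has_cycle :: "'a graph \<Rightarrow> bool" where
  "has_cycle G \<longleftrightarrow> (\<exists>n \<ge> 3. \<exists>f. inj_on f {..<n} \<and> f ` {..<n} \<subseteq> verts G \<and>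
     (\<forall>i < n. adj G (f i) (f (Suc i mod n))))"

definition connected_graph :: "'a graph \<Rightarrow> bool" where
  "connected_graph G \<longleftrightarrow> verts G \<noteq> {} \<and> (\<forall>u \<in> verts G. \<forall>v \<in> verts G. (adj G)\<^sup>*\<^sup>* u v)"

definition is_tree :: "'a graph \<Rightarrow> bool" where
  "is_tree G \<longleftrightarrow> simple_graph G \<and> connected_graph G \<and> \<not> has_cycle G"

definition complete_to :: "'a graph \<Rightarrow> 'a set \<Rightarrow> 'a set \<Rightarrow> bool" where
  "complete_to G A B \<longleftrightarrow> (\<forall>a \<in> A. \<forall>b \<in> B. adj G a b)"

definition anticomplete_to :: "'a graph \<Rightarrow> 'a set \<Rightarrow> 'a set \<Rightarrow> bool" where
  "anticomplete_to G A B \<longleftrightarrow> (\<forall>a \<in> A. \<forall>b \<in> B. \<not> adj G a b)"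

definition H0 :: "nat graph" where
  "H0 = Graph {..<10} ([{0, 1, 2, 3}]\<^bsup>2\<^esup> \<union> [{0, 4, 5, 6}]\<^bsup>2\<^esup> \<union> [{0, 7, 8, 9}]\<^bsup>2\<^esup>)"

text \<open>
  \<open>T\<close> is the vertex set of the tree, which is the subgraph of \<open>H\<close> induced by \<open>T\<close>, and
  \<open>\<D>\<close> is the set of the vertex sets of the triangles.
\<close>

definition tree_with_triangles :: "'a graph \<Rightarrow> bool" where
  "tree_with_triangles H \<longleftrightarrow> simple_graph H \<and> (\<exists>T \<D>.
     verts H = T \<union> \<Union>\<D> \<and> T \<inter> \<Union>\<D> = {} \<and>
     is_tree (induced_subgraph H T) \<and> card T \<ge> 2 \<and>
     (\<forall>v \<in> T. degree (induced_subgraph H T) v \<le> 3) \<and>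
     (\<forall>D \<in> \<D>. card D = 3 \<and> clique D (edges H)) \<and>
     (\<forall>D \<in> \<D>. \<forall>D' \<in> \<D>. D \<noteq> D' \<longrightarrow> D \<inter> D' = {} \<and> anticomplete_to H D D') \<and>
     (\<forall>D \<in> \<D>. \<exists>v \<in> T. complete_to H D {v} \<and> anticomplete_to H D (T - {v})) \<and>
     (\<forall>v \<in> T. degree (induced_subgraph H T) v = 1 \<longrightarrow>
        card {D \<in> \<D>. complete_to H {v} D} = 2) \<and>
     (\<forall>v \<in> T. degree (induced_subgraph H T) v = 2 \<longrightarrow>
        card {D \<in> \<D>. complete_to H {v} D} = 1) \<and>
     (\<forall>v \<in> T. degree (induced_subgraph H T) v = 3 \<longrightarrow>
        anticomplete_to H {v} (verts H - T)))"

text \<open>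
  All graphs here are finite, so every isomorphism type has a representative whose vertices are
  natural numbers.
\<close>

definition family_T :: "nat graph set" where
  "family_T = {H0} \<union> {H. tree_with_triangles H}"

text \<open>
  The grid is \<open>\<int> \<times> \<int>\<close>; since graphs are finite, the paths of a representation lie in a finite
  rectangle. The path \<open>Horizontal y a b\<close> runs from \<open>(a, y)\<close> to \<open>(b, y)\<close>,
  and \<open>Vertical x a b\<close> from \<open>(x, a)\<close> to \<open>(x, b)\<close>.
\<close>

datatype grid_path = Horizontal int int int | Vertical int int int

fun positive_length :: "grid_path \<Rightarrow> bool" where
  "positive_length (Horizontal y a b) \<longleftrightarrow> a < b"
| "positive_length (Vertical x a b) \<longleftrightarrow> a < b"

fun grid_points :: "grid_path \<Rightarrow> (int \<times> int) set" where
  "grid_points (Horizontal y a b) = {a..b} \<times> {y}"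
| "grid_points (Vertical x a b) = {x} \<times> {a..b}"

fun interior_points :: "grid_path \<Rightarrow> (int \<times> int) set" where
  "interior_points (Horizontal y a b) = {a<..<b} \<times> {y}"
| "interior_points (Vertical x a b) = {x} \<times> {a<..<b}"

fun grid_edges :: "grid_path \<Rightarrow> (int \<times> int) set set" where
  "grid_edges (Horizontal y a b) = (\<lambda>i. {(i, y), (i + 1, y)}) ` {a..<b}"
| "grid_edges (Vertical x a b) = (\<lambda>i. {(x, i), (x, i + 1)}) ` {a..<b}"

definition contact_B0_VPG_rep :: "'a graph \<Rightarrow> ('a \<Rightarrow> grid_path) \<Rightarrow> bool" where
  "contact_B0_VPG_rep G P \<longleftrightarrow>
     (\<forall>v \<in> verts G. positive_length (P v)) \<and>
     (\<forall>u \<in> verts G. \<forall>v \<in> verts G. u \<noteq> v \<longrightarrow>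
        grid_edges (P u) \<inter> grid_edges (P v) = {} \<and>
        interior_points (P u) \<inter> interior_points (P v) = {} \<and>
        (adj G u v \<longleftrightarrow> grid_points (P u) \<inter> grid_points (P v) \<noteq> {}))"

definition contact_B0_VPG :: "'a graph \<Rightarrow> bool" where
  "contact_B0_VPG G \<longleftrightarrow> (\<exists>P. contact_B0_VPG_rep G P)"

end

theory Submission
  imports Defs "HOL-Library.Product_Plus"
begin

text \<open>
  Axis-parallel segments that meet pairwise have a common point, so every clique of at least three
  vertices sits at one grid point. At most four paths meet there, and when there are four, all of
  them end there. Hence a vertex loses an end of its path to each \<open>K\<^sub>4\<close> that contains it, while
  in a smaller block at most one vertex can pass through the common point. A member of \<open>\<T>\<close> needs
  more ends than its paths have.

  Conversely, a chordal graph without \<open>K\<^sub>4\<^sup>-\<close> is a block graph. Leaf blocks \<open>insert v X\<close> are removed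
  one by one, keeping track of the number \<open>r v\<close> of ends of the path of each \<open>v\<close> that are needed for
  the blocks removed before. If the block is a \<open>K\<^sub>4\<close>, or if some vertex of \<open>X\<close> needs both of its
  ends, then the block uses an end of \<open>v\<close>; otherwise it is attached to the interior of the path of
  \<open>v\<close>. When this fails, the places where demand exceeds supply form a tree with triangles.
\<close>

section \<open>Graphs\<close>

text \<open>The demand \<open>r\<close> makes the induction close. If a removed block uses an end of
  \<open>v\<close>, what remains is the same statement for the smaller graph with \<open>r v\<close>
  raised by one. An obstruction found there either does not rely on the extra unit, or the removed
  block takes its place: as a triangle at \<open>v\<close> when the block is a K4, and otherwise as
  a new leaf of the tree, namely a vertex of the block that needs both of its ends. So
  \<open>r\<close> is arbitrary although the theorem needs only \<open>r = 0\<close>. The choice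
  made at a leaf block loses nothing: an end of \<open>v\<close> is given up only where every
  representation must give one up, since a vertex that keeps both ends free passes through the
  common point and no second path may do so. The constant 3 in an obstruction is one more than the
  two ends of a path. A representation may have no room for further paths, hence the scalings: by 2
  to create an interior point private to \<open>v\<close>, by 3 to surround a point by a box that
  only the paths through it enter.\<close>

lemma adj_sym: "adj G u v \<longleftrightarrow> adj G v u"
  by (simp add: adj_def insert_commute)

lemma simple_graphD:
  assumes "simple_graph G" "adj G u v"
  shows "u \<in> verts G" "v \<in> verts G" "u \<noteq> v"
proof -
  have "{u, v} \<in> [verts G]\<^bsup>2\<^esup>"
    using assms unfolding simple_graph_def adj_def by blast
  then show "u \<in> verts G" "v \<in> verts G" "u \<noteq> v"
    by (auto simp: nsets_def)
qed

lemma finite_verts [simp]: "simple_graph G \<Longrightarrow> finite (verts G)"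
  by (simp add: simple_graph_def)

lemma verts_induced_subgraph [simp]: "verts (induced_subgraph G S) = verts G \<inter> S"
  by (simp add: induced_subgraph_def)

lemma adj_induced_subgraph [simp]:
  "adj (induced_subgraph G S) u v \<longleftrightarrow> adj G u v \<and> u \<in> S \<and> v \<in> S"
  by (auto simp: induced_subgraph_def adj_def)

lemma induced_subgraph_induced_subgraph [simp]:
  "induced_subgraph (induced_subgraph G S) T = induced_subgraph G (S \<inter> T)"
  by (auto simp: induced_subgraph_def)

lemma simple_induced_subgraph: "simple_graph G \<Longrightarrow> simple_graph (induced_subgraph G S)"
  by (auto simp: simple_graph_def induced_subgraph_def nsets_def)

lemma clique_adj: "clique S (edges G) \<longleftrightarrow> (\<forall>u \<in> S. \<forall>v \<in> S. u \<noteq> v \<longrightarrow> adj G u v)"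
  by (simp add: clique_def adj_def)

text \<open>Embeddings go from the small graph to the large one. In this form they compose, and
  representations can be pulled back along them.\<close>

lemma has_induced_iff:
  "has_induced G H \<longleftrightarrow> (\<exists>g. inj_on g (verts H) \<and> g ` verts H \<subseteq> verts G \<and>
     (\<forall>u \<in> verts H. \<forall>v \<in> verts H. adj H u v \<longleftrightarrow> adj G (g u) (g v)))" (is "?L \<longleftrightarrow> ?R")
proof
  assume ?L
  then obtain S f where S: "S \<subseteq> verts G" and f: "bij_betw f S (verts H)"
    and adj: "\<forall>u \<in> S. \<forall>v \<in> S. adj G u v \<longleftrightarrow> adj H (f u) (f v)"
    unfolding has_induced_def graph_iso_def by (auto simp: Int_absorb1)
  let ?g = "inv_into S f"
  have "bij_betw ?g (verts H) S"
    using f by (rule bij_betw_inv_into)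
  moreover have "adj H u v \<longleftrightarrow> adj G (?g u) (?g v)" if "u \<in> verts H" "v \<in> verts H" for u v
    using that adj f calculation bij_betwE[of ?g "verts H" S]
    by (metis bij_betw_inv_into_right)
  ultimately show ?R
    using S by (intro exI[of _ ?g]) (auto simp: bij_betw_def)
next
  assume ?R
  then obtain g where g: "inj_on g (verts H)" "g ` verts H \<subseteq> verts G"
    and adj: "\<And>u v. u \<in> verts H \<Longrightarrow> v \<in> verts H \<Longrightarrow> adj H u v \<longleftrightarrow> adj G (g u) (g v)"
    by (elim exE conjE) (rule that; simp)
  let ?S = "g ` verts H"
  have "bij_betw (inv_into (verts H) g) ?S (verts H)"
    using g by (simp add: bij_betw_inv_into inj_on_imp_bij_betw)
  then have "graph_iso (induced_subgraph G ?S) H"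
    unfolding graph_iso_def using g adj
    by (intro exI[of _ "inv_into (verts H) g"]) (auto simp: Int_absorb1)
  then show ?L
    using g(2) unfolding has_induced_def by blast
qed

lemma has_induced_trans:
  assumes "has_induced G H" "has_induced H K"
  shows "has_induced G K"
proof -
  obtain g where g: "inj_on g (verts H)" "g ` verts H \<subseteq> verts G"
    "\<forall>u \<in> verts H. \<forall>v \<in> verts H. adj H u v \<longleftrightarrow> adj G (g u) (g v)"
    using assms(1) unfolding has_induced_iff by metis
  obtain h where h: "inj_on h (verts K)" "h ` verts K \<subseteq> verts H"
    "\<forall>u \<in> verts K. \<forall>v \<in> verts K. adj K u v \<longleftrightarrow> adj H (h u) (h v)"
    using assms(2) unfolding has_induced_iff by metis
  have "inj_on (g \<circ> h) (verts K)"
    using g(1) h(1,2) by (metis comp_inj_on inj_on_subset)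
  then show ?thesis
    unfolding has_induced_iff using g(2,3) h(2,3)
    by (intro exI[of _ "g \<circ> h"]) (auto simp: image_subset_iff)
qed

lemma has_induced_induced_subgraph: "has_induced G (induced_subgraph G S)"
  unfolding has_induced_iff by (intro exI[of _ id]) auto

lemma has_induced_subgraph: "has_induced (induced_subgraph G S) H \<Longrightarrow> has_induced G H"
  using has_induced_trans has_induced_induced_subgraph by blast

lemma chordal_induced_subgraph: "chordal G \<Longrightarrow> chordal (induced_subgraph G S)"
  using has_induced_subgraph unfolding chordal_def by blast

section \<open>Small forbidden graphs and their consequences\<close>

lemma adj_complete_graph: "adj (complete_graph n) i j \<longleftrightarrow> i < n \<and> j < n \<and> i \<noteq> j"
  by (auto simp: adj_def complete_graph_def nsets_def)

lemma adj_K4_minus: "adj K4_minus i j \<longleftrightarrow> i < 4 \<and> j < 4 \<and> i \<noteq> j \<and> {i, j} \<noteq> {0, 1}"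
proof -
  have "{i, j} \<in> [{..<4}]\<^bsup>2\<^esup> \<longleftrightarrow> i < 4 \<and> j < 4 \<and> i \<noteq> j"
    by (auto simp: nsets_2_eq doubleton_eq_iff)
  then show ?thesis
    by (simp add: adj_def K4_minus_def)
qed

lemma adj_cycle_graph:
  assumes "n \<ge> 3" "i < n" "j < n"
  shows "adj (cycle_graph n) i j \<longleftrightarrow> j = Suc i mod n \<or> i = Suc j mod n"
  using assms by (auto simp: adj_def cycle_graph_def doubleton_eq_iff)

text \<open>Used with \<open>c d\<close> an edge: its common neighbours are pairwise adjacent, which
  makes the blocks of a chordal graph cliques.\<close>

lemma K4_minus_free_adj:
  assumes "\<not> has_induced G K4_minus" "simple_graph G" "a \<noteq> b"
    and "adj G a c" "adj G a d" "adj G b c" "adj G b d" "adj G c d"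
  shows "adj G a b"
proof (rule ccontr)
  assume nab: "\<not> adj G a b"
  \<comment> \<open>The non-adjacent pair takes the positions 0 and 1, whose edge
    \<open>K4_minus\<close> lacks.\<close>
  define g where "g i = [a, b, c, d] ! i" for i
  have V: "verts K4_minus = {0, 1, 2, 3}"
    by (auto simp: K4_minus_def)
  have ne: "a \<noteq> c" "a \<noteq> d" "b \<noteq> c" "b \<noteq> d" "c \<noteq> d"
    using simple_graphD(3)[OF assms(2)] assms(4-8) by blast+
  have irr: "\<not> adj G u u" for u
    using simple_graphD(3)[OF assms(2)] by blast
  have inv: "{a, b, c, d} \<subseteq> verts G"
    using simple_graphD(1,2)[OF assms(2)] assms(4-8) by blast
  have g: "g 0 = a" "g 1 = b" "g (Suc 0) = b" "g 2 = c" "g 3 = d"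
    by (simp_all add: g_def numeral_eq_Suc)
  have "inj_on g (verts K4_minus)"
    unfolding V using ne assms(3) by (simp add: g inj_on_def) 
  moreover have "g ` verts K4_minus \<subseteq> verts G"
    unfolding V using inv by (simp add: g)
  moreover have "\<forall>u \<in> verts K4_minus. \<forall>v \<in> verts K4_minus. adj K4_minus u v \<longleftrightarrow> adj G (g u) (g v)"
    unfolding V using nab irr assms(4-8) adj_sym[of G]
    by (auto simp: g adj_K4_minus doubleton_eq_iff)
  ultimately show False
    using assms(1) unfolding has_induced_iff by blast
qed

lemma K5_free_clique_card:
  assumes "\<not> has_induced G (complete_graph n)" "simple_graph G"
    and "clique Q (edges G)" "Q \<subseteq> verts G"
  shows "card Q < n"
proof (rule ccontr)
  assume "\<not> card Q < n"
  then obtain R where R: "R \<subseteq> Q" "card R = n"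
    by (meson not_less obtain_subset_with_card_n)
  have "finite R"
    using R assms(2,4) finite_verts finite_subset by metis
  then obtain g where g: "bij_betw g {..<n} R"
    using R(2) by (metis ex_bij_betw_nat_finite lessThan_atLeast0)
  have "g i \<in> R" if "i < n" for i
    using g that bij_betwE by blast
  moreover have "g i = g j \<longleftrightarrow> i = j" if "i < n" "j < n" for i j
    using g that by (auto simp: bij_betw_def inj_on_def)
  moreover have "adj G u v \<longleftrightarrow> u \<noteq> v" if "u \<in> R" "v \<in> R" for u v
    using that R(1) assms(3) simple_graphD(3)[OF assms(2)] unfolding clique_adj by blast
  moreover have "verts (complete_graph n) = {..<n}"
    by (simp add: complete_graph_def)
  moreover have "inj_on g {..<n}" "g ` {..<n} \<subseteq> verts G"
    using g R(1) assms(4) by (auto simp: bij_betw_def)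
  ultimately have "has_induced G (complete_graph n)"
    unfolding has_induced_iff by (intro exI[of _ g]) (simp add: adj_complete_graph)
  then show False
    using assms(1) by contradiction
qed

section \<open>Cycles in graphs\<close>

text \<open>A walk that follows \<open>s\<close> never turns back, so in a finite graph it closes up to a cycle.\<close>

lemma has_cycle_if_nonbacktracking:
  assumes "simple_graph G" "v0 \<in> verts G"
    and s: "\<And>v. v \<in> verts G \<Longrightarrow> adj G v (s v)" "\<And>v. v \<in> verts G \<Longrightarrow> s (s v) \<noteq> v"
  shows "has_cycle G"
proof -
  define x where "x i = (s ^^ i) v0" for i
  have x_Suc: "x (Suc i) = s (x i)" for i
    by (simp add: x_def)
  have x_in: "x i \<in> verts G" for i
  proof (induction i)
    case (Suc i)
    then show ?case
      using s(1) simple_graphD(2)[OF assms(1)] by (auto simp: x_Suc)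
  qed (simp add: x_def assms(2))
  have x_adj: "adj G (x i) (x (Suc i))" for i
    using s(1) x_in by (simp add: x_Suc)
  \<comment> \<open>\<open>P d\<close> says that the walk returns to some vertex after
    \<open>d\<close> steps. For the least such \<open>d\<close> the vertices in between are
    distinct; \<open>d = 1\<close> would be a loop and \<open>d = 2\<close> a turn back, so
    \<open>d\<close> is at least 3.\<close>
  define P where "P d \<longleftrightarrow> d > 0 \<and> (\<exists>i. x i = x (i + d))" for d
  have "\<not> inj x"
    using finite_subset[of "range x" "verts G"] x_in assms(1) finite_imageD[of x UNIV] by auto
  then obtain i j where "x i = x j" "i \<noteq> j"
    by (auto simp: inj_on_def)
  then have "\<exists>d. P d"
  proof (induction i j rule: linorder_wlog)
    case (le a b)
    then have "P (b - a)"
      by (auto simp: P_def intro!: exI[of _ a])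
    then show ?case ..
  qed metis
  then obtain d where d: "P d" "\<And>d'. d' < d \<Longrightarrow> \<not> P d'"
    using exists_least_iff[of P] by auto
  then obtain i where i: "x i = x (i + d)" "d > 0"
    by (auto simp: P_def)
  have "d \<noteq> 1"
    using i x_adj[of i] simple_graphD(3)[OF assms(1)] by (metis Suc_eq_plus1)
  moreover have "d \<noteq> 2"
    using i s(2)[OF x_in[of i]] by (auto simp: x_Suc numeral_2_eq_2)
  ultimately have "d \<ge> 3"
    using i(2) by linarith
  moreover have "inj_on (\<lambda>k. x (i + k)) {..<d}"
  proof (rule linorder_inj_onI)
    fix k l assume kl: "k < l" "k \<in> {..<d}" "l \<in> {..<d}"
    show "x (i + k) \<noteq> x (i + l)"
    proof
      assume "x (i + k) = x (i + l)"
      then have "P (l - k)"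
        using kl(1) by (auto simp: P_def intro!: exI[of _ "i + k"])
      then show False
        using d(2)[of "l - k"] kl(3) by (auto simp: less_imp_diff_less)
    qed
  qed auto
  moreover have "adj G (x (i + k)) (x (i + Suc k mod d))" if "k < d" for k
  proof (cases "Suc k = d")
    case True
    then show ?thesis
      using x_adj[of "i + k"] i by auto
  next
    case False
    then show ?thesis
      using x_adj[of "i + k"] that by simp
  qed
  ultimately show ?thesis
    unfolding has_cycle_def using x_in
    by (intro exI[of _ d] conjI exI[of _ "\<lambda>k. x (i + k)"]) auto
qed

lemma has_cycle_triangle:
  assumes "simple_graph G" "adj G a b" "adj G b c" "adj G c a"
  shows "has_cycle G"
proof -
  define f where "f i = [a, b, c] ! i" for i
  have f: "f 0 = a" "f (Suc 0) = b" "f 2 = c"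
    by (simp_all add: f_def numeral_2_eq_2)
  have *: "{..<3::nat} = {0, Suc 0, 2}"
    by auto
  have "inj_on f {..<3}" "f ` {..<3} \<subseteq> verts G"
    using simple_graphD[OF assms(1,2)] simple_graphD[OF assms(1,3)] simple_graphD[OF assms(1,4)]
    unfolding * inj_on_def by (auto simp: f)
  moreover have "\<forall>i \<in> {..<3}. adj G (f i) (f (Suc i mod 3))"
    using assms(2-4) unfolding * by (simp add: f numeral_2_eq_2[symmetric])
  ultimately show ?thesis
    unfolding has_cycle_def by (intro exI[of _ 3]) auto
qed

lemma is_tree_singleton:
  assumes "simple_graph G" "v \<in> verts G"
  shows "is_tree (induced_subgraph (G :: 'a graph) {v})"
proof -
  have "\<not> has_cycle (induced_subgraph G {v})"
  proof
    assume "has_cycle (induced_subgraph G {v})"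
    then obtain n and f :: "nat \<Rightarrow> 'a" where n: "n \<ge> 3" "inj_on f {..<n}" "f ` {..<n} \<subseteq> {v}"
      unfolding has_cycle_def by force
    then have "card {..<n} \<le> 1"
      using card_inj_on_le[OF n(2,3)] by simp
    then show False
      using n(1) by simp
  qed
  then show ?thesis
    using assms simple_induced_subgraph
    by (auto simp: is_tree_def connected_graph_def)
qed

text \<open>On a cycle through \<open>x\<close> the two neighbours of \<open>x\<close> are distinct
  and lie in \<open>T\<close>, but \<open>v\<close> is the only candidate. A cycle avoiding
  \<open>x\<close> would already lie in the old tree.\<close>

lemma is_tree_insert_leaf:
  assumes G: "simple_graph G" and T: "is_tree (induced_subgraph G T)" "T \<subseteq> verts G" "v \<in> T"
    and x: "x \<notin> T" "adj G v x" "\<And>w. w \<in> T \<Longrightarrow> adj G x w \<Longrightarrow> w = v"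
  shows "is_tree (induced_subgraph G (insert x T))"
proof -
  let ?A = "induced_subgraph G T" and ?B = "induced_subgraph G (insert x T)"
  have xV: "x \<in> verts G"
    using x(2) simple_graphD[OF G] by blast
  have adjAB: "(adj ?B)\<^sup>*\<^sup>* a b" if "(adj ?A)\<^sup>*\<^sup>* a b" for a b
    using that by (rule rtranclp_mono[THEN predicate2D, rotated]) auto
  have conA: "(adj ?A)\<^sup>*\<^sup>* a b" if "a \<in> T" "b \<in> T" for a b
    using T that unfolding is_tree_def connected_graph_def by auto
  have vx: "adj ?B v x" "adj ?B x v"
    using x(2) T(3) adj_sym[of G] by auto
  have tov: "(adj ?B)\<^sup>*\<^sup>* a v" "(adj ?B)\<^sup>*\<^sup>* v a" if "a \<in> insert x T" for a
    using that vx adjAB conA T(3) by auto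
  have "connected_graph ?B"
    unfolding connected_graph_def using tov xV by (auto intro: rtranclp_trans)
  moreover have "\<not> has_cycle ?B"
  proof
    assume "has_cycle ?B"
    then obtain n f where n: "n \<ge> 3" "inj_on f {..<n}" "f ` {..<n} \<subseteq> verts G \<inter> insert x T"
      and fadj: "\<And>i. i < n \<Longrightarrow> adj ?B (f i) (f (Suc i mod n))"
      unfolding has_cycle_def by auto
    show False
    proof (cases "x \<in> f ` {..<n}")
      case True
      then obtain i where i: "i < n" "f i = x"
        by auto
      \<comment> \<open>\<open>j\<close> and \<open>k\<close> are the cyclic predecessor and
        successor of \<open>i\<close>; they differ because the cycle has at least 3
        vertices.\<close>
      define j where "j = (if i = 0 then n - 1 else i - 1)"
      have j: "j < n" "Suc j mod n = i"
        using n(1) i(1) by (auto simp: j_def)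
      define k where "k = Suc i mod n"
      have k: "k < n" 
        using n(1) by (simp add: k_def)
      have "k \<noteq> j"
        using n(1) i(1) by (cases "Suc i = n") (auto simp: j_def k_def)
      have "adj G x (f k)" "adj G (f j) x"
        using fadj[OF i(1)] fadj[OF j(1)] by (auto simp: i k_def j)
      moreover have "f k \<in> T" "f j \<in> T"
        using calculation n(3) k j(1) simple_graphD(3)[OF G] by (metis Int_iff image_subset_iff insertE lessThan_iff)+
      ultimately have "f k = f j"
        using x(3) adj_sym[of G] by metis
      then show False
        using n(2) k j(1) \<open>k \<noteq> j\<close> by (auto simp: inj_on_def)
    next
      case False
      then have fT: "f i \<in> T" if "i < n" for i
        using n(3) that by auto
      then have "has_cycle ?A"
        unfolding has_cycle_def using n fadj
        by (intro exI[of _ n] exI[of _ f]) auto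
      then show False
        using T(1) by (simp add: is_tree_def)
    qed
  qed
  ultimately show ?thesis
    using simple_induced_subgraph[OF G] by (simp add: is_tree_def)
qed

section \<open>Grid paths\<close>

definition meets :: "grid_path \<Rightarrow> grid_path \<Rightarrow> bool" where
  "meets P Q \<longleftrightarrow> grid_points P \<inter> grid_points Q \<noteq> {}"

definition compatible :: "grid_path \<Rightarrow> grid_path \<Rightarrow> bool" where
  "compatible P Q \<longleftrightarrow> grid_edges P \<inter> grid_edges Q = {} \<and> interior_points P \<inter> interior_points Q = {}"

fun ends :: "grid_path \<Rightarrow> (int \<times> int) set" where
  "ends (Horizontal y a b) = {(a, y), (b, y)}"
| "ends (Vertical x a b) = {(x, a), (x, b)}"

lemma contact_B0_VPG_rep_iff:
  "contact_B0_VPG_rep G P \<longleftrightarrow> (\<forall>v \<in> verts G. positive_length (P v)) \<and>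
     (\<forall>u \<in> verts G. \<forall>v \<in> verts G. u \<noteq> v \<longrightarrow>
        compatible (P u) (P v) \<and> (adj G u v \<longleftrightarrow> meets (P u) (P v)))"
  by (auto simp: contact_B0_VPG_rep_def compatible_def meets_def)

lemma contact_B0_VPG_repD:
  assumes "contact_B0_VPG_rep G P"
  shows "v \<in> verts G \<Longrightarrow> positive_length (P v)"
    and "u \<in> verts G \<Longrightarrow> v \<in> verts G \<Longrightarrow> u \<noteq> v \<Longrightarrow> compatible (P u) (P v)"
    and "u \<in> verts G \<Longrightarrow> v \<in> verts G \<Longrightarrow> u \<noteq> v \<Longrightarrow> adj G u v \<longleftrightarrow> meets (P u) (P v)"
  using assms unfolding contact_B0_VPG_rep_iff by blast+

lemma compatible_sym: "compatible P Q \<longleftrightarrow> compatible Q P"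
  by (auto simp: compatible_def)

lemma meets_sym: "meets P Q \<longleftrightarrow> meets Q P"
  by (auto simp: meets_def)

text \<open>Collinear paths without a common grid edge have disjoint interiors, and perpendicular
  paths never share a grid edge, so for each pair of orientations one of the two conditions decides.
  Disjoint interiors alone would not do for collinear paths, since a path of length one has no
  interior grid point.\<close>

lemma compatible_simps:
  assumes "a < b" "c < d"
  shows "compatible (Horizontal y a b) (Horizontal z c d) \<longleftrightarrow> y \<noteq> z \<or> b \<le> c \<or> d \<le> a"
    and "compatible (Vertical x a b) (Vertical w c d) \<longleftrightarrow> x \<noteq> w \<or> b \<le> c \<or> d \<le> a"
    and "compatible (Horizontal y a b) (Vertical x c d) \<longleftrightarrow> \<not> (a < x \<and> x < b \<and> c < y \<and> y < d)"
    and "compatible (Vertical x c d) (Horizontal y a b) \<longleftrightarrow> \<not> (a < x \<and> x < b \<and> c < y \<and> y < d)"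
proof -
  have edges: "{a..<b} \<inter> {c..<d} = {} \<longleftrightarrow> b \<le> c \<or> d \<le> a"
    and interior: "b \<le> c \<or> d \<le> a \<Longrightarrow> {a<..<b} \<inter> {c<..<d} = {}"
    using assms by (auto simp: min_def max_def)
  \<comment> \<open>A grid edge determines its line and its lower endpoint, so common edges
    correspond to common indices on a common line.\<close>
  have image: "f ` A \<inter> g ` B = {} \<longleftrightarrow> \<not> S \<or> A \<inter> B = {}"
    if "\<And>i j. f i = g j \<longleftrightarrow> S \<and> i = j" for f g :: "int \<Rightarrow> (int \<times> int) set" and A B S
  proof -
    have "f ` A \<inter> g ` B = {} \<longleftrightarrow> (\<forall>i \<in> A. \<forall>j \<in> B. f i \<noteq> g j)"
      by blast
    then show ?thesis
      unfolding that by blast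
  qed
  have "grid_edges (Horizontal y a b) \<inter> grid_edges (Horizontal z c d) = {} \<longleftrightarrow> \<not> y = z \<or> {a..<b} \<inter> {c..<d} = {}"
    unfolding grid_edges.simps by (rule image) (auto simp: doubleton_eq_iff)
  then show "compatible (Horizontal y a b) (Horizontal z c d) \<longleftrightarrow> y \<noteq> z \<or> b \<le> c \<or> d \<le> a"
    using interior assms by (auto simp: compatible_def edges Times_Int_Times simp del: grid_edges.simps)
  have "grid_edges (Vertical x a b) \<inter> grid_edges (Vertical w c d) = {} \<longleftrightarrow> \<not> x = w \<or> {a..<b} \<inter> {c..<d} = {}"
    unfolding grid_edges.simps by (rule image) (auto simp: doubleton_eq_iff)
  then show "compatible (Vertical x a b) (Vertical w c d) \<longleftrightarrow> x \<noteq> w \<or> b \<le> c \<or> d \<le> a"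
    using interior assms by (auto simp: compatible_def edges Times_Int_Times simp del: grid_edges.simps)
  show "compatible (Horizontal y a b) (Vertical x c d) \<longleftrightarrow> \<not> (a < x \<and> x < b \<and> c < y \<and> y < d)"
    "compatible (Vertical x c d) (Horizontal y a b) \<longleftrightarrow> \<not> (a < x \<and> x < b \<and> c < y \<and> y < d)"
    by (auto simp: compatible_def doubleton_eq_iff Times_Int_Times Int_insert_left Int_insert_right
        split: if_splits)
qed

lemma meets_simps:
  assumes "a < b" "c < d"
  shows "meets (Horizontal y a b) (Horizontal z c d) \<longleftrightarrow> y = z \<and> a \<le> d \<and> c \<le> b"
    and "meets (Vertical x a b) (Vertical w c d) \<longleftrightarrow> x = w \<and> a \<le> d \<and> c \<le> b"
    and "meets (Horizontal y a b) (Vertical x c d) \<longleftrightarrow> a \<le> x \<and> x \<le> b \<and> c \<le> y \<and> y \<le> d"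
    and "meets (Vertical x c d) (Horizontal y a b) \<longleftrightarrow> a \<le> x \<and> x \<le> b \<and> c \<le> y \<and> y \<le> d"
proof -
  have "{a..b} \<inter> {c..d} \<noteq> {} \<longleftrightarrow> a \<le> d \<and> c \<le> b"
    using assms by (auto simp: min_def max_def)
  then show "meets (Horizontal y a b) (Horizontal z c d) \<longleftrightarrow> y = z \<and> a \<le> d \<and> c \<le> b"
    and "meets (Vertical x a b) (Vertical w c d) \<longleftrightarrow> x = w \<and> a \<le> d \<and> c \<le> b"
    by (auto simp: meets_def Times_Int_Times)
qed (auto simp: meets_def Times_Int_Times Int_insert_left Int_insert_right split: if_splits)

section \<open>Ends and contact points\<close>

lemma card_ends: "positive_length P \<Longrightarrow> card (ends P) = 2"
  by (cases P) auto

lemma finite_ends [simp]: "finite (ends P)"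
  by (cases P) auto

lemma ends_subset_grid_points: "positive_length P \<Longrightarrow> ends P \<subseteq> grid_points P"
  by (cases P) auto

lemma grid_points_cases:
  "p \<in> grid_points P \<Longrightarrow> p \<notin> ends P \<Longrightarrow> p \<in> interior_points P"
  by (cases P; cases p) auto

text \<open>Perpendicular lines meet only once, and two common points of collinear paths would
  enclose a common grid edge.\<close>

lemma compatible_common_point_unique:
  assumes "positive_length P" "positive_length Q" "compatible P Q"
    and "p \<in> grid_points P" "p \<in> grid_points Q" "q \<in> grid_points P" "q \<in> grid_points Q"
  shows "p = q"
  using assms by (cases P; cases Q; cases p; cases q) (auto simp: compatible_simps)

text \<open>A path is a product of two intervals, so the Helly property of intervals applies in each
  coordinate; the largest lower bounds give the common point.\<close>

lemma grid_points_Helly: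
  assumes "meets P Q" "meets P R" "meets Q R"
  obtains p where "p \<in> grid_points P" "p \<in> grid_points Q" "p \<in> grid_points R"
proof -
  define box :: "int \<Rightarrow> int \<Rightarrow> int \<Rightarrow> int \<Rightarrow> (int \<times> int) set" where "box a b c d = {a..b} \<times> {c..d}" for a b c d
  have box: "\<exists>a b c d. grid_points S = box a b c d" for S
  proof (cases S)
    case (Horizontal y a b)
    then have "grid_points S = box a b y y"
      by (simp add: box_def)
    then show ?thesis by blast
  next
    case (Vertical x a b)
    then have "grid_points S = box x x a b"
      by (simp add: box_def)
    then show ?thesis by blast
  qed
  obtain a b c d where P: "grid_points P = box a b c d" using box by blast
  obtain a' b' c' d' where Q: "grid_points Q = box a' b' c' d'" using box by blast
  obtain a'' b'' c'' d'' where R: "grid_points R = box a'' b'' c'' d''" using box by blast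
  have "(max a (max a' a''), max c (max c' c'')) \<in> box a b c d \<inter> box a' b' c' d' \<inter> box a'' b'' c'' d''"
    using assms by (auto simp: meets_def P Q R box_def)
  then show thesis
    using that P Q R by blast
qed

text \<open>For \<open>p\<close> on the path, these unit steps stand for the grid edges at
  \<open>p\<close> that the path uses. There are only four of them at \<open>p\<close>, which is the
  source of the bound 4 on cliques.\<close>

definition directions :: "int \<times> int \<Rightarrow> grid_path \<Rightarrow> (int \<times> int) set" where
  "directions p P = {d \<in> {(1, 0), (-1, 0), (0, 1), (0, -1)}. p + d \<in> grid_points P}"

lemma directions_nonempty:
  assumes "positive_length P" "p \<in> grid_points P"
  shows "directions p P \<noteq> {}"
proof -
  have "p + (1, 0) \<in> grid_points P \<or> p + (-1, 0) \<in> grid_points P \<or>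
    p + (0, 1) \<in> grid_points P \<or> p + (0, -1) \<in> grid_points P"
    using assms by (cases P; cases p) auto
  then show ?thesis
    unfolding directions_def by blast
qed

lemma card_directions_interior:
  assumes "p \<in> interior_points P"
  shows "card (directions p P) \<ge> 2"
proof -
  have "{(1, 0), (-1, 0)} \<subseteq> directions p P \<or> {(0, 1), (0, -1)} \<subseteq> directions p P"
    using assms by (cases P; cases p) (auto simp: directions_def)
  moreover have "card {(1, 0), (-1, 0) :: int \<times> int} = 2" "card {(0, 1), (0, -1) :: int \<times> int} = 2"
    by auto
  moreover have "finite (directions p P)"
    by (simp add: directions_def)
  ultimately show ?thesis
    by (metis card_mono)
qed

text \<open>A common direction \<open>d\<close> would make \<open>p + d\<close> a second common
  point, so uniqueness forces \<open>d = 0\<close>, which is not a direction.\<close>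

lemma directions_disjoint:
  assumes "positive_length P" "positive_length Q" "compatible P Q"
    and "p \<in> grid_points P" "p \<in> grid_points Q"
  shows "directions p P \<inter> directions p Q = {}"
proof -
  have nonzero: "(0 :: int \<times> int) \<notin> directions p P"
    by (simp add: directions_def zero_prod_def)
  have "d = 0" if "d \<in> directions p P" "d \<in> directions p Q" for d
  proof -
    have "p + d \<in> grid_points P" "p + d \<in> grid_points Q"
      using that unfolding directions_def by blast+
    then have "p = p + d"
      by (rule compatible_common_point_unique[OF assms])
    then show ?thesis
      by simp
  qed
  then show ?thesis
    using nonzero by blast
qed

section \<open>Contact representations\<close>

text \<open>Embeddings pull representations back, so for the forward direction it is enough to
  exclude the forbidden graphs themselves.\<close>

lemma contact_B0_VPG_has_induced:
  assumes "has_induced G H" "contact_B0_VPG G"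
  shows "contact_B0_VPG H"
proof -
  obtain P where P: "contact_B0_VPG_rep G P"
    using assms(2) by (auto simp: contact_B0_VPG_def)
  obtain g where g: "inj_on g (verts H)" "g ` verts H \<subseteq> verts G"
    and adj: "\<forall>u \<in> verts H. \<forall>v \<in> verts H. adj H u v \<longleftrightarrow> adj G (g u) (g v)"
    using assms(1) unfolding has_induced_iff by metis
  have "g u \<noteq> g v" if "u \<in> verts H" "v \<in> verts H" "u \<noteq> v" for u v
    using that g(1) by (auto simp: inj_on_def)
  then have "contact_B0_VPG_rep H (P \<circ> g)"
    using P g(2) adj unfolding contact_B0_VPG_rep_iff by (auto simp: image_subset_iff)
  then show ?thesis
    by (auto simp: contact_B0_VPG_def)
qed

text \<open>The contact of \<open>u\<close> and \<open>v\<close> is a single point. Any third path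
  of the clique has a common point with these two by the Helly property, and it can only be that
  one.\<close>

lemma contact_clique_point:
  assumes P: "contact_B0_VPG_rep G P" and K: "K \<subseteq> verts G" "clique K (edges G)"
    and u: "u \<in> K" and v: "v \<in> K" and ne: "u \<noteq> v"
  obtains p where "\<And>w. w \<in> K \<Longrightarrow> p \<in> grid_points (P w)"
proof -
  note PD = contact_B0_VPG_repD[OF P]
  have meets: "meets (P w) (P z)" if "w \<in> K" "z \<in> K" "w \<noteq> z" for w z
    using PD(3) K that unfolding clique_adj by blast
  obtain p where p: "p \<in> grid_points (P u)" "p \<in> grid_points (P v)"
    using meets[OF u v ne] by (auto simp: meets_def)
  have "p \<in> grid_points (P w)" if w: "w \<in> K" for w
  proof (cases "w = u \<or> w = v")
    case False
    then obtain q where q: "q \<in> grid_points (P u)" "q \<in> grid_points (P v)" "q \<in> grid_points (P w)"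
      using grid_points_Helly meets[OF u v ne] meets[OF u w] meets[OF v w] by metis
    then have "p = q"
      using compatible_common_point_unique[of "P u" "P v"] PD(1,2) p u v ne K(1) by blast
    then show ?thesis
      using q by simp
  qed (use p in auto)
  then show thesis ..
qed

text \<open>The paths through \<open>p\<close> share out four directions, and each takes at least
  one. A path with \<open>p\<close> in its interior takes two, which leaves too few for three
  others.\<close>

lemma contact_point_card:
  assumes P: "contact_B0_VPG_rep G P" and K: "K \<subseteq> verts G" "finite K" "v \<in> K"
    and p: "\<And>w. w \<in> K \<Longrightarrow> p \<in> grid_points (P w)"
  shows "card K \<le> 4" and "card K = 4 \<Longrightarrow> p \<in> ends (P v)"
proof -
  note PD = contact_B0_VPG_repD[OF P]
  let ?d = "\<lambda>w. directions p (P w)"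
  have fin: "finite (?d w)" for w
    by (simp add: directions_def)
  have "(\<Sum>w\<in>K. card (?d w)) = card (\<Union>w\<in>K. ?d w)"
    using directions_disjoint PD(1,2) K p
    by (intro card_UN_disjoint[symmetric] ballI impI) (auto simp: directions_def subset_iff)
  also have "\<dots> \<le> card {(1, 0), (-1, 0), (0, 1), (0, -1) :: int \<times> int}"
    by (intro card_mono) (auto simp: directions_def)
  finally have sum: "(\<Sum>w\<in>K. card (?d w)) \<le> 4"
    by simp
  have ge1: "card (?d w) \<ge> 1" if "w \<in> K" for w
    using directions_nonempty PD(1) K p that fin
    by (metis One_nat_def Suc_leI card_gt_0_iff subsetD)
  have rest: "(\<Sum>w\<in>K - {v}. card (?d w)) \<ge> card K - 1"
    using sum_mono[of "K - {v}" "\<lambda>_. 1" "\<lambda>w. card (?d w)"] ge1 K by simp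
  have split: "(\<Sum>w\<in>K. card (?d w)) = card (?d v) + (\<Sum>w\<in>K - {v}. card (?d w))"
    using K by (simp add: sum.remove)
  show "card K \<le> 4"
    using sum split rest ge1[OF K(3)] by linarith
  show "p \<in> ends (P v)" if "card K = 4"
  proof (rule ccontr)
    assume "p \<notin> ends (P v)"
    then have "card (?d v) \<ge> 2"
      using card_directions_interior grid_points_cases p K(3) by blast
    then show False
      using sum split rest that by linarith
  qed
qed

section \<open>The two small forbidden graphs\<close>

lemma not_contact_K5: "\<not> contact_B0_VPG (complete_graph 5)"
proof
  assume "contact_B0_VPG (complete_graph 5)"
  then obtain P where P: "contact_B0_VPG_rep (complete_graph 5) P"
    by (auto simp: contact_B0_VPG_def)
  let ?K = "{..<5::nat}"
  have K: "?K \<subseteq> verts (complete_graph 5)" "clique ?K (edges (complete_graph 5))"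
    unfolding clique_adj by (auto simp: adj_complete_graph) (simp add: complete_graph_def)
  obtain p where "\<And>w. w \<in> ?K \<Longrightarrow> p \<in> grid_points (P w)"
    using contact_clique_point[OF P K, of 0 1] by auto
  then have "card ?K \<le> 4"
    by (intro contact_point_card(1)[OF P K(1), of 0]) auto
  then show False by simp
qed

text \<open>Both triangles contain the edge between 2 and 3, so their common points coincide with
  the single contact of these two, and the paths of 0 and 1 would meet there.\<close>

lemma not_contact_K4_minus: "\<not> contact_B0_VPG K4_minus"
proof
  assume "contact_B0_VPG K4_minus"
  then obtain P where P: "contact_B0_VPG_rep K4_minus P"
    by (auto simp: contact_B0_VPG_def)
  note PD = contact_B0_VPG_repD[OF P]
  have V: "verts K4_minus = {..<4}"
    by (simp add: K4_minus_def)
  have cl: "clique {0, 2, 3} (edges K4_minus)" "clique {1, 2, 3} (edges K4_minus)"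
    by (auto simp: clique_adj adj_K4_minus doubleton_eq_iff)
  obtain p where p: "\<And>w. w \<in> {0, 2, 3} \<Longrightarrow> p \<in> grid_points (P w)"
    using contact_clique_point[OF P _ cl(1), of 2 3] by (auto simp: V)
  obtain q where q: "\<And>w. w \<in> {1, 2, 3} \<Longrightarrow> q \<in> grid_points (P w)"
    using contact_clique_point[OF P _ cl(2), of 2 3] by (auto simp: V)
  have "p = q"
    using compatible_common_point_unique[of "P 2" "P 3"] PD(1,2) p q by (simp add: V)
  then have "meets (P 0) (P 1)"
    using p[of 0] q[of 1] by (auto simp: meets_def)
  then have "adj K4_minus 0 1"
    using PD(3)[of 0 1] by (simp add: V)
  then show False
    by (simp add: adj_K4_minus)
qed

section \<open>Obstructions\<close>

text \<open>
  \<open>r v\<close> is the number of ends of the path of \<open>v\<close> that must be left unused, and \<open>\<rho> v\<close> is how many of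
  these the obstruction makes use of. With \<open>r = 0\<close>, \<open>card T = 1\<close> gives \<open>H0\<close> and
  \<open>card T \<ge> 2\<close> the other members of the family.
\<close>

definition obstruction ::
    "'a graph \<Rightarrow> ('a \<Rightarrow> nat) \<Rightarrow> 'a set \<Rightarrow> 'a set set \<Rightarrow> ('a \<Rightarrow> nat) \<Rightarrow> bool" where
  "obstruction G r T \<D> \<rho> \<longleftrightarrow> T \<subseteq> verts G \<and> \<Union>\<D> \<subseteq> verts G \<and> T \<inter> \<Union>\<D> = {} \<and>
     is_tree (induced_subgraph G T) \<and>
     (\<forall>D \<in> \<D>. card D = 3 \<and> clique D (edges G)) \<and>
     (\<forall>D \<in> \<D>. \<forall>D' \<in> \<D>. D \<noteq> D' \<longrightarrow> D \<inter> D' = {} \<and> anticomplete_to G D D') \<and>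
     (\<forall>D \<in> \<D>. \<exists>v \<in> T. complete_to G D {v} \<and> anticomplete_to G D (T - {v})) \<and>
     (\<forall>v \<in> T. \<rho> v \<le> r v \<and>
        degree (induced_subgraph G T) v + card {D \<in> \<D>. complete_to G {v} D} + \<rho> v = 3)"

definition obstructed :: "'a graph \<Rightarrow> ('a \<Rightarrow> nat) \<Rightarrow> bool" where
  "obstructed G r \<longleftrightarrow> (\<exists>T \<D> \<rho>. obstruction G r T \<D> \<rho>)"

text \<open>
  Every vertex \<open>v\<close> of the tree takes part in three contacts with triangles or tree neighbours, so one
  of them is not at an end of its path. It is a contact with a tree neighbour \<open>s v\<close>, whose path has
  to end there. The walk along \<open>s\<close> never turns back, which is impossible in a tree.
\<close>

lemma obstructed_not_contact:
  assumes G: "simple_graph G" and "obstructed G (\<lambda>_. 0)"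
  shows "\<not> contact_B0_VPG G"
proof
  assume "contact_B0_VPG G"
  then obtain P where P: "contact_B0_VPG_rep G P"
    by (auto simp: contact_B0_VPG_def)
  note PD = contact_B0_VPG_repD[OF P]
  obtain T \<D> \<rho> where T: "T \<subseteq> verts G" and DV: "\<Union>\<D> \<subseteq> verts G" and disj: "T \<inter> \<Union>\<D> = {}"
    and tree: "is_tree (induced_subgraph G T)"
    and D3: "\<forall>D \<in> \<D>. card D = 3 \<and> clique D (edges G)"
    and DD: "\<forall>D \<in> \<D>. \<forall>D' \<in> \<D>. D \<noteq> D' \<longrightarrow> D \<inter> D' = {} \<and> anticomplete_to G D D'"
    and DT: "\<forall>D \<in> \<D>. \<exists>v \<in> T. complete_to G D {v} \<and> anticomplete_to G D (T - {v})"
    and deg: "\<forall>v \<in> T. \<rho> v \<le> 0 \<and>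
      degree (induced_subgraph G T) v + card {D \<in> \<D>. complete_to G {v} D} + \<rho> v = 3"
    using assms(2) unfolding obstructed_def obstruction_def by (elim exE conjE) (rule that; assumption)
  note D3 = bspec[OF D3] and DD = DD[rule_format] and DT = bspec[OF DT]
  let ?GT = "induced_subgraph G T"
  have GT: "simple_graph ?GT"
    using G by (rule simple_induced_subgraph)
  define N where "N v = {u \<in> T. adj G v u}" for v
  define K where "K v = {D \<in> \<D>. complete_to G {v} D}" for v
  have deg_N: "card (N v) + card (K v) = 3" if "v \<in> T" for v
  proof -
    have "{u \<in> verts ?GT. adj ?GT v u} = N v"
      using that T by (auto simp: N_def)
    then show ?thesis
      using bspec[OF deg that] by (simp add: degree_def K_def)
  qed
  have fin: "finite (N v)" "finite (K v)" for v
  proof -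
    show "finite (N v)"
      using T G by (auto simp: N_def intro: finite_subset)
    have "finite \<D>"
      using DV G by (meson finite_UnionD finite_subset finite_verts)
    then show "finite (K v)"
      by (simp add: K_def)
  qed
  have same: "p = q" if "u \<in> verts G" "v \<in> verts G" "u \<noteq> v" "p \<in> grid_points (P u)" "p \<in> grid_points (P v)"
    "q \<in> grid_points (P u)" "q \<in> grid_points (P v)" for u v p q
    using compatible_common_point_unique[of "P u" "P v" p q] PD(1,2) that by blast
  have adjI: "adj G u v" if "p \<in> grid_points (P u)" "p \<in> grid_points (P v)" "u \<in> verts G" "v \<in> verts G" "u \<noteq> v" for p u v
    using that PD(3) by (auto simp: meets_def)
  have irr: "u \<noteq> v" if "adj G u v" for u v
    using simple_graphD(3)[OF G that] .
  \<comment> \<open>Otherwise all three contacts of \<open>v\<close> are at its ends.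
    \<open>f\<close> picks the contact with a tree neighbour and \<open>g\<close> the one with a
    triangle. A coincidence would make vertices adjacent that are not, or close a triangle inside
    the tree, so there would be three ends.\<close>
  have "\<exists>u \<in> N v. \<exists>p. p \<in> grid_points (P v) \<and> p \<in> grid_points (P u) \<and> p \<notin> ends (P v)" if v: "v \<in> T" for v
  proof (rule ccontr)
    assume contr: "\<not> ?thesis"
    have vV: "v \<in> verts G"
      using v T by blast
    have "\<exists>p. p \<in> grid_points (P v) \<and> p \<in> grid_points (P u)" if "u \<in> N v" for u
    proof -
      have "meets (P v) (P u)"
        using PD(3)[OF vV, of u] that T irr by (auto simp: N_def)
      then show ?thesis
        by (auto simp: meets_def)
    qed
    then obtain f where f: "\<And>u. u \<in> N v \<Longrightarrow> f u \<in> grid_points (P v) \<and> f u \<in> grid_points (P u)"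
      by metis
    have "\<exists>p. p \<in> ends (P v) \<and> (\<forall>w \<in> D. p \<in> grid_points (P w))" if D: "D \<in> K v" for D
    proof -
      have D': "D \<in> \<D>" "complete_to G {v} D"
        using D by (auto simp: K_def)
      have vD: "v \<notin> D"
        using disj v D'(1) by blast
      have card: "card (insert v D) = 4"
        using D3[OF D'(1)] vD by (simp add: card_gt_0_iff[symmetric] card_insert_if[OF card_ge_0_finite])
      then have fD: "finite (insert v D)"
        by (metis card.infinite zero_neq_numeral)
      have sub: "insert v D \<subseteq> verts G"
        using DV D'(1) vV by blast
      have cl: "clique (insert v D) (edges G)"
        using D3[OF D'(1)] D'(2) adj_sym[of G] unfolding clique_adj complete_to_def by blast
      obtain x where x: "x \<in> D"
        using D3[OF D'(1)] by fastforce
      obtain p where p: "\<And>w. w \<in> insert v D \<Longrightarrow> p \<in> grid_points (P w)"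
        using contact_clique_point[OF P sub cl, of v x] x vD by blast
      then have "p \<in> ends (P v)"
        using contact_point_card(2)[OF P sub fD _ p] card by blast
      then show ?thesis
        using p by blast
    qed
    then obtain g where g: "\<And>D. D \<in> K v \<Longrightarrow> g D \<in> ends (P v) \<and> (\<forall>w \<in> D. g D \<in> grid_points (P w))"
      by metis
    have f_ends: "f u \<in> ends (P v)" if "u \<in> N v" for u
      using f that contr by blast
    have "inj_on f (N v)"
    proof (rule inj_onI, rule ccontr)
      fix u w assume uw: "u \<in> N v" "w \<in> N v" "f u = f w" "u \<noteq> w"
      then have "adj G u w"
        using adjI[of "f u" u w] f[of u] f[of w] T by (auto simp: N_def)
      then have "has_cycle ?GT"
        using uw v adj_sym[of G] by (intro has_cycle_triangle[OF GT, of v u w]) (auto simp: N_def)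
      then show False
        using tree by (simp add: is_tree_def)
    qed
    moreover have "inj_on g (K v)"
    proof (rule inj_onI, rule ccontr)
      fix D D' assume D: "D \<in> K v" "D' \<in> K v" "g D = g D'" "D \<noteq> D'"
      then have D': "D \<in> \<D>" "D' \<in> \<D>"
        by (auto simp: K_def)
      obtain x x' where x: "x \<in> D" "x' \<in> D'"
        using D3[OF D'(1)] D3[OF D'(2)] by fastforce
      have "x \<noteq> x'" "\<not> adj G x x'"
        using DD[OF D' D(4)] x by (auto simp: anticomplete_to_def)
      moreover have "g D \<in> grid_points (P x)" "g D \<in> grid_points (P x')"
        using g[OF D(1)] g[OF D(2)] D(3) x by auto
      ultimately show False
        using adjI[of "g D" x x'] x D' DV by blast
    qed
    moreover have "f ` N v \<inter> g ` K v = {}"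
    proof (rule ccontr)
      assume "f ` N v \<inter> g ` K v \<noteq> {}"
      then obtain u D where u: "u \<in> N v" and D: "D \<in> K v" and eq: "f u = g D"
        unfolding disjoint_iff by (metis imageE)
      have D': "D \<in> \<D>" "complete_to G {v} D"
        using D by (auto simp: K_def)
      obtain x where x: "x \<in> D"
        using D3[OF D'(1)] by fastforce
      obtain v' where v': "v' \<in> T" "complete_to G D {v'}" "anticomplete_to G D (T - {v'})"
        using DT[OF D'(1)] by blast
      have "adj G x v"
        using D'(2) x adj_sym[of G] by (auto simp: complete_to_def)
      then have "v' = v"
        using v'(3) x v by (auto simp: anticomplete_to_def)
      then have "\<not> adj G x u" 
        using v'(3) x u irr by (auto simp: anticomplete_to_def N_def)
      moreover have "x \<noteq> u"
        using x u D'(1) disj by (auto simp: N_def)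
      ultimately show False
        using adjI[of "g D" x u] f[OF u] g[OF D] eq x u T DV D'(1) by (auto simp: N_def)
    qed
    ultimately have "card (f ` N v \<union> g ` K v) = 3"
      using deg_N[OF v] fin[of v] by (simp add: card_Un_disjoint card_image)
    moreover have "f ` N v \<union> g ` K v \<subseteq> ends (P v)"
      using f_ends g by blast
    ultimately have "3 \<le> card (ends (P v))"
      by (metis card_mono finite_ends)
    then show False
      using card_ends PD(1)[OF vV] by simp
  qed
  then obtain s where s: "\<And>v. v \<in> T \<Longrightarrow> s v \<in> N v \<and>
      (\<exists>p. p \<in> grid_points (P v) \<and> p \<in> grid_points (P (s v)) \<and> p \<notin> ends (P v))"
    by metis
  \<comment> \<open>The contact of \<open>v\<close> and \<open>s v\<close> is a single point, so it
    would be interior to both paths.\<close>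
  have "s (s v) \<noteq> v" if v: "v \<in> T" for v
  proof
    assume ss: "s (s v) = v"
    have sv: "s v \<in> T" "s v \<noteq> v"
      using s[OF v] irr[of v "s v"] by (auto simp: N_def)
    obtain p where p: "p \<in> grid_points (P v)" "p \<in> grid_points (P (s v))" "p \<notin> ends (P v)"
      using s[OF v] by blast
    obtain q where q: "q \<in> grid_points (P (s v))" "q \<in> grid_points (P v)" "q \<notin> ends (P (s v))"
      using s[OF sv(1)] unfolding ss by blast
    have "v \<in> verts G" "s v \<in> verts G"
      using v sv(1) T by auto
    then have "p = q"
      using same[OF _ _ sv(2)[symmetric] p(1,2) q(2,1)] by simp
    then have "p \<in> interior_points (P v) \<inter> interior_points (P (s v))"
      using p q grid_points_cases by blast
    then show False
      using PD(2)[of v "s v"] sv v T by (auto simp: compatible_def)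
  qed
  moreover have "adj ?GT v (s v)" if "v \<in> T" for v
    using s[OF that] that by (simp add: N_def)
  moreover obtain v0 where "v0 \<in> T"
    using tree by (auto simp: is_tree_def connected_graph_def)
  ultimately have "has_cycle ?GT"
    using T by (intro has_cycle_if_nonbacktracking[OF GT, of v0 s]) auto
  then show False
    using tree by (simp add: is_tree_def)
qed

text \<open>The degrees 1, 2, 3 come with 2, 1, 0 triangles, so the sum is always 3. Degree 0 cannot
  occur in a connected graph with at least two vertices.\<close>

lemma tree_with_triangles_obstructed:
  assumes "tree_with_triangles H"
  shows "simple_graph H" "obstructed H (\<lambda>_. 0)"
proof -
  show H: "simple_graph H"
    using assms by (simp add: tree_with_triangles_def)
  obtain T \<D> where V: "verts H = T \<union> \<Union>\<D>" and disj: "T \<inter> \<Union>\<D> = {}"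
    and tree: "is_tree (induced_subgraph H T)" and card: "card T \<ge> 2"
    and deg3: "\<forall>v \<in> T. degree (induced_subgraph H T) v \<le> 3"
    and D: "\<forall>D \<in> \<D>. card D = 3 \<and> clique D (edges H)"
     "\<forall>D \<in> \<D>. \<forall>D' \<in> \<D>. D \<noteq> D' \<longrightarrow> D \<inter> D' = {} \<and> anticomplete_to H D D'"
     "\<forall>D \<in> \<D>. \<exists>v \<in> T. complete_to H D {v} \<and> anticomplete_to H D (T - {v})"
    and deg: "\<forall>v \<in> T. degree (induced_subgraph H T) v = 1 \<longrightarrow> card {D \<in> \<D>. complete_to H {v} D} = 2"
     "\<forall>v \<in> T. degree (induced_subgraph H T) v = 2 \<longrightarrow> card {D \<in> \<D>. complete_to H {v} D} = 1"
     "\<forall>v \<in> T. degree (induced_subgraph H T) v = 3 \<longrightarrow> anticomplete_to H {v} (verts H - T)"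
    using assms unfolding tree_with_triangles_def by (elim conjE exE) (rule that; assumption)
  have "degree (induced_subgraph H T) v + card {D \<in> \<D>. complete_to H {v} D} = 3" if v: "v \<in> T" for v
  proof -
    let ?N = "{u \<in> verts (induced_subgraph H T). adj (induced_subgraph H T) v u}"
    obtain w where w: "w \<in> T" "w \<noteq> v"
      using card v by (metis card_le_Suc0_iff_eq card.infinite not_less_eq_eq numeral_2_eq_2 zero_le)
    have "(adj (induced_subgraph H T))\<^sup>*\<^sup>* v w"
      using tree V v w by (auto simp: is_tree_def connected_graph_def)
    then obtain u where "adj (induced_subgraph H T) v u"
      using w(2) by (metis converse_rtranclpE)
    then have "?N \<noteq> {}"
      using simple_graphD(2)[OF H] by auto
    moreover have "finite ?N"
      using H by simp
    ultimately have "degree (induced_subgraph H T) v \<noteq> 0"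
      by (simp only: degree_def card_eq_0_iff) blast
    moreover have "card {D \<in> \<D>. complete_to H {v} D} = 0" if "degree (induced_subgraph H T) v = 3"
    proof -
      have "\<not> complete_to H {v} D" if "D \<in> \<D>" for D
      proof -
        obtain x where "x \<in> D"
          using D(1) \<open>D \<in> \<D>\<close> by fastforce
        moreover have "x \<in> verts H - T"
          using V disj calculation \<open>D \<in> \<D>\<close> by blast
        ultimately show ?thesis
          using deg(3) v \<open>degree _ v = 3\<close> by (auto simp: complete_to_def anticomplete_to_def)
      qed
      then have "{D \<in> \<D>. complete_to H {v} D} = {}"
        by blast
      then show ?thesis
        by (simp only: card.empty)
    qed
    ultimately show ?thesis
      using bspec[OF deg3 v] bspec[OF deg(1) v] bspec[OF deg(2) v] by (auto simp: le_Suc_eq numeral_3_eq_3)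
  qed
  then show "obstructed H (\<lambda>_. 0)"
    unfolding obstructed_def obstruction_def using V disj tree D
    by (intro exI[of _ T] exI[of _ \<D>] exI[of _ "\<lambda>_. 0"]) simp
qed

lemma adj_H0:
  "adj H0 i j \<longleftrightarrow> i \<noteq> j \<and> (\<exists>A \<in> {{0, 1, 2, 3}, {0, 4, 5, 6}, {0, 7, 8, 9}}. i \<in> A \<and> j \<in> A)"
proof -
  have "{i, j} \<in> [A]\<^bsup>2\<^esup> \<longleftrightarrow> i \<noteq> j \<and> i \<in> A \<and> j \<in> A" for A :: "nat set"
    by (auto simp: nsets_2_eq doubleton_eq_iff)
  then show ?thesis
    unfolding adj_def H0_def by simp blast
qed

lemma simple_H0: "simple_graph H0"
  by (auto simp: simple_graph_def H0_def nsets_def)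

text \<open>This is the degenerate case of a one-vertex tree: degree 0 and three triangles.\<close>

lemma obstructed_H0: "obstructed H0 (\<lambda>_. 0)"
proof -
  let ?D = "{{1, 2, 3}, {4, 5, 6}, {7, 8, 9}} :: nat set set"
  have V: "verts H0 = {0, 1, 2, 3, 4, 5, 6, 7, 8, 9}"
    by (auto simp: H0_def)
  have "{u \<in> verts (induced_subgraph H0 {0}). adj (induced_subgraph H0 {0}) 0 u} = {}"
    by (auto simp: adj_H0)
  then have deg: "degree (induced_subgraph H0 {0}) 0 = 0"
    unfolding degree_def by (simp only: card.empty)
  have "{D \<in> ?D. complete_to H0 {0} D} = ?D"
    by (auto simp: complete_to_def adj_H0)
  moreover have "card ?D = 3"
  proof -
    have "{1, 2, 3} \<noteq> {4, 5, 6 :: nat}" "{1, 2, 3} \<noteq> {7, 8, 9 :: nat}" "{4, 5, 6} \<noteq> {7, 8, 9 :: nat}"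
      by (rule notI, drule equalityD1, simp)+
    then show ?thesis
      by (simp only: card_insert_if finite.intros insert_iff empty_iff card.empty) simp
  qed
  ultimately have tri: "card {D \<in> ?D. complete_to H0 {0} D} = 3"
    by simp
  have "\<forall>D \<in> ?D. card D = 3 \<and> clique D (edges H0)"
    by (simp add: clique_adj adj_H0)
  moreover have "\<forall>D \<in> ?D. \<forall>D' \<in> ?D. D \<noteq> D' \<longrightarrow> D \<inter> D' = {} \<and> anticomplete_to H0 D D'"
    by (simp add: anticomplete_to_def adj_H0)
  moreover have "\<forall>D \<in> ?D. complete_to H0 D {0} \<and> anticomplete_to H0 D ({0} - {0})"
    by (simp add: complete_to_def anticomplete_to_def adj_H0)
  ultimately show ?thesis
    unfolding obstructed_def obstruction_def using deg tri is_tree_singleton[OF simple_H0, of 0]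
    by (intro exI[of _ "{0}"] exI[of _ ?D] exI[of _ "\<lambda>_. 0"]) (simp add: V)
qed

section \<open>Leaf blocks of chordal graphs without \<open>K4_minus\<close>\<close>

definition induced_path :: "'a graph \<Rightarrow> 'a list \<Rightarrow> bool" where
  "induced_path G xs \<longleftrightarrow> xs \<noteq> [] \<and> distinct xs \<and> set xs \<subseteq> verts G \<and>
     (\<forall>i < length xs. \<forall>j < length xs. adj G (xs ! i) (xs ! j) \<longleftrightarrow> j = Suc i \<or> i = Suc j)"

lemma induced_path_Cons:
  assumes G: "simple_graph G" and ys: "induced_path G ys"
    and y: "y \<notin> set ys" "adj G y (ys ! 0)"
    and non: "\<And>k. 1 \<le> k \<Longrightarrow> k < length ys \<Longrightarrow> \<not> adj G y (ys ! k)"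
  shows "induced_path G (y # ys)"
proof -
  have irr: "\<not> adj G y y" "y \<in> verts G"
    using simple_graphD[OF G] y(2) by blast+
  have y_adj: "adj G y (ys ! k) \<longleftrightarrow> k = 0" if "k < length ys" for k
    using non[of k] y(2) that by (cases k) auto
  then have y_adj': "adj G (ys ! k) y \<longleftrightarrow> k = 0" if "k < length ys" for k
    using that adj_sym[of G] by blast
  have "adj G ((y # ys) ! i) ((y # ys) ! j) \<longleftrightarrow> j = Suc i \<or> i = Suc j"
    if "i < length (y # ys)" "j < length (y # ys)" for i j
    using that ys irr(1) y_adj y_adj' by (cases i; cases j) (auto simp: induced_path_def)
  then show ?thesis
    using ys y(1) irr(2) unfolding induced_path_def by auto
qed

lemma induced_path_tl:
  assumes "induced_path G xs" "length xs \<ge> 2"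
  shows "induced_path G (tl xs)"
proof -
  obtain x ys where xs: "xs = x # ys" "ys \<noteq> []"
    using assms(2) by (cases xs; cases "tl xs") auto
  have "adj G (ys ! i) (ys ! j) \<longleftrightarrow> j = Suc i \<or> i = Suc j" if "i < length ys" "j < length ys" for i j
  proof -
    have "adj G (xs ! Suc i) (xs ! Suc j) \<longleftrightarrow> Suc j = Suc (Suc i) \<or> Suc i = Suc (Suc j)"
      using assms(1) that unfolding induced_path_def xs by (metis Suc_less_eq length_Cons)
    then show ?thesis
      by (simp add: xs)
  qed
  then show ?thesis
    using assms(1) xs(2) unfolding induced_path_def xs(1) by auto
qed

text \<open>The first neighbour of \<open>y\<close> beyond position 1 would close an induced cycle
  of length at least 4.\<close>

lemma chordal_induced_path_chord:
  assumes G: "simple_graph G" "chordal G" and xs: "induced_path G xs"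
    and y: "y \<notin> set xs" "adj G y (xs ! 0)" "\<not> adj G y (xs ! 1)"
    and k: "2 \<le> k" "k < length xs"
  shows "\<not> adj G y (xs ! k)"
proof
  assume adj_k: "adj G y (xs ! k)"
  let ?P = "\<lambda>j. 2 \<le> j \<and> j < length xs \<and> adj G y (xs ! j)"
  define j where "j = (LEAST j. ?P j)"
  have j: "2 \<le> j" "j < length xs" "adj G y (xs ! j)"
    using LeastI[of ?P k] k adj_k unfolding j_def by blast+
  have min: "\<not> ?P i" if "i < j" for i
    using not_less_Least[of i ?P] that unfolding j_def by blast
  have y_adj: "adj G y (xs ! i) \<longleftrightarrow> i = 0 \<or> i = j" if "i \<le> j" for i
  proof -
    consider "i = 0" | "i = 1" | "2 \<le> i" "i < j" | "i = j"
      using \<open>i \<le> j\<close> by linarith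
    then show ?thesis
      using y(2,3) j min[of i] by cases auto
  qed
  then have y_adj': "adj G (xs ! i) y \<longleftrightarrow> i = 0 \<or> i = j" if "i \<le> j" for i
    using that adj_sym[of G] by blast
  \<comment> \<open>The cycle follows the path from 0 to \<open>j\<close> and returns through
    \<open>y\<close>, which is placed at index \<open>j + 1\<close>; hence the length
    \<open>j + 2\<close>.\<close>
  define g where "g i = (if i = Suc j then y else xs ! i)" for i
  let ?n = "Suc (Suc j)"
  have V: "verts (cycle_graph ?n) = {..<?n}"
    by (simp add: cycle_graph_def)
  have irr: "\<not> adj G y y" "y \<in> verts G"
    using simple_graphD[OF G(1)] y(2) by blast+
  have sub: "xs ! i \<in> verts G" if "i \<le> j" for i
    using xs j that by (auto simp: induced_path_def subset_iff)
  have ne: "xs ! i \<noteq> y" if "i \<le> j" for i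
    using y(1) j(2) that by auto
  have "inj_on g {..<?n}"
  proof (rule inj_onI)
    fix a b assume "a \<in> {..<?n}" "b \<in> {..<?n}" "g a = g b"
    then show "a = b"
      using xs j(2) ne[of a] ne[of b]
      by (cases "a = Suc j"; cases "b = Suc j") (auto simp: g_def induced_path_def nth_eq_iff_index_eq)
  qed
  moreover have "g ` {..<?n} \<subseteq> verts G"
    using sub irr(2) by (auto simp: g_def)
  moreover have "adj (cycle_graph ?n) a b \<longleftrightarrow> adj G (g a) (g b)" if "a < ?n" "b < ?n" for a b
  proof -
    have cyc: "adj (cycle_graph ?n) a b \<longleftrightarrow> b = Suc a mod ?n \<or> a = Suc b mod ?n"
      using j(1) that by (intro adj_cycle_graph) auto
    consider "a \<le> j" "b \<le> j" | "a = Suc j" "b \<le> j" | "a \<le> j" "b = Suc j" | "a = Suc j" "b = Suc j"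
      using \<open>a < ?n\<close> \<open>b < ?n\<close> by linarith
    then show ?thesis
    proof cases
      case 1
      then show ?thesis
        using xs j(2) unfolding cyc by (auto simp: g_def induced_path_def)
    next
      case 2
      then show ?thesis
        using y_adj[of b] unfolding cyc by (auto simp: g_def)
    next
      case 3
      then show ?thesis
        using y_adj'[of a] unfolding cyc by (auto simp: g_def)
    next
      case 4
      then show ?thesis
        using irr(1) j(1) unfolding cyc by (auto simp: g_def)
    qed
  qed
  ultimately have "has_induced G (cycle_graph ?n)"
    unfolding has_induced_iff V by (intro exI[of _ g]) auto
  then show False
    using spec[OF G(2)[unfolded chordal_def], of ?n] j(1) by simp
qed

text \<open>Take a longest induced path, starting with \<open>x0, x1\<close>. Every vertex of the
  block of this edge, except \<open>x1\<close>, can replace \<open>x0\<close> in it, so a neighbour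
  of such a vertex outside the block would extend the path.\<close>

lemma leaf_block_exists:
  assumes G: "simple_graph G" "chordal G" and K: "\<not> has_induced G K4_minus" and ab: "adj G a b"
  obtains v X where "v \<in> verts G" "X \<noteq> {}" "X \<subseteq> verts G" "v \<notin> X" "clique (insert v X) (edges G)"
    "\<And>x y. x \<in> X \<Longrightarrow> adj G x y \<Longrightarrow> y \<in> insert v X"
proof -
  note irr = simple_graphD(3)[OF G(1)]
  note inV = simple_graphD(1,2)[OF G(1)]
  let ?P = "\<lambda>xs. induced_path G xs \<and> length xs \<ge> 2"
  have "induced_path G [b]"
    using inV[OF ab] irr by (auto simp: induced_path_def)
  then have "?P [a, b]"
    using ab irr[OF ab] by (auto intro!: induced_path_Cons[OF G(1)])
  moreover have "length xs < Suc (card (verts G))" if "?P xs" for xs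
    using that card_mono[of "verts G" "set xs"] G(1)
    by (auto simp: induced_path_def distinct_card less_Suc_eq_le)
  ultimately obtain xs where xs: "?P xs" and longest: "\<And>ys. ?P ys \<Longrightarrow> length ys \<le> length xs"
    using ex_has_greatest_nat[of ?P "[a, b]" length "Suc (card (verts G))"] by (metis less_imp_le)
  obtain x0 x1 zs where xs_eq: "xs = x0 # x1 # zs"
    using xs by (cases xs; cases "tl xs") auto
  have path: "induced_path G (x1 # zs)"
    using induced_path_tl[of G xs] xs by (simp add: xs_eq)
  have x0_adj: "adj G x0 ((x1 # zs) ! k) \<longleftrightarrow> k = 0" if "k < length (x1 # zs)" for k
  proof -
    have "adj G (xs ! 0) (xs ! Suc k) \<longleftrightarrow> Suc k = Suc 0 \<or> 0 = Suc (Suc k)"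
      using xs that unfolding induced_path_def xs_eq by (metis Suc_less_eq length_Cons zero_less_Suc)
    then show ?thesis
      by (simp add: xs_eq)
  qed
  have x01: "adj G x0 x1"
    using x0_adj[of 0] by simp
  have x1_adj: "adj G x1 (zs ! k) \<longleftrightarrow> k = 0" if "k < length zs" for k
  proof -
    have "adj G ((x1 # zs) ! 0) ((x1 # zs) ! Suc k) \<longleftrightarrow> Suc k = Suc 0 \<or> 0 = Suc (Suc k)"
      using path that unfolding induced_path_def by (metis Suc_less_eq length_Cons zero_less_Suc)
    then show ?thesis
      by simp
  qed
  have x0_notin: "x0 \<notin> set (x1 # zs)"
    using xs by (simp add: xs_eq induced_path_def)
  \<comment> \<open>\<open>x0\<close> and the common neighbours of \<open>x0\<close> and
    \<open>x1\<close>: the block of the edge, without the vertex \<open>x1\<close> at which it may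
    be attached.\<close>
  define X where "X = {x. adj G x x1 \<and> (x = x0 \<or> adj G x x0)}"
  have path': "x \<notin> set (x1 # zs)" "\<And>k. 1 \<le> k \<Longrightarrow> k < length (x1 # zs) \<Longrightarrow> \<not> adj G x ((x1 # zs) ! k)"
    "induced_path G (x # x1 # zs)" if x: "x \<in> X" for x
  proof -
    have xx1: "adj G x x1"
      using x by (simp add: X_def)
    show notin: "x \<notin> set (x1 # zs)"
    proof
      assume "x \<in> set (x1 # zs)"
      moreover from this have "x \<noteq> x0"
        using x0_notin by blast
      ultimately obtain k where k: "k < length (x1 # zs)" "x = (x1 # zs) ! k"
        by (metis in_set_conv_nth)
      then have "adj G x0 x"
        using x \<open>x \<noteq> x0\<close> adj_sym[of G] by (auto simp: X_def)
      then have "x = x1"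
        using x0_adj[of k] k by simp
      then show False
        using xx1 irr by blast
    qed
    show non: "\<not> adj G x ((x1 # zs) ! k)" if k: "1 \<le> k" "k < length (x1 # zs)" for k
    proof (cases "x = x0")
      case True
      then show ?thesis
        using x0_adj[of k] k by simp
    next
      case False
      then have xx0: "adj G x x0"
        using x by (simp add: X_def)
      \<comment> \<open>Otherwise \<open>x0\<close> and \<open>zs ! 0\<close> would both be adjacent
        to the two ends of the edge \<open>x x1\<close>, and hence to each other. For later vertices
        of the path chordality takes over.\<close>
      have not1: "\<not> adj G x (zs ! 0)" if "zs \<noteq> []"
      proof
        assume adj: "adj G x (zs ! 0)"
        have "x0 \<noteq> zs ! 0"
          using x0_notin that by (auto simp: in_set_conv_nth)
        moreover have "adj G x1 (zs ! 0)"
          using x1_adj[of 0] that by simp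
        ultimately have "adj G x0 (zs ! 0)"
          using K4_minus_free_adj[OF K G(1), of x0 "zs ! 0" x x1] xx0 xx1 x01 adj adj_sym[of G] by blast
        then show False
          using x0_adj[of 1] that by simp
      qed
      show ?thesis
      proof (cases "k = 1")
        case True
        then show ?thesis
          using not1 k by auto
      next
        case False
        then have k2: "2 \<le> k" "zs \<noteq> []"
          using k by auto
        have "adj G x ((x1 # zs) ! 0)" "\<not> adj G x ((x1 # zs) ! 1)"
          using xx1 not1[OF k2(2)] by simp_all
        then show ?thesis
          using chordal_induced_path_chord[OF G path notin] k2(1) k(2) by blast
      qed
    qed
    show "induced_path G (x # x1 # zs)"
      using notin xx1 non by (intro induced_path_Cons[OF G(1) path]) auto
  qed
  have closed: "y \<in> insert x1 X" if x: "x \<in> X" and y: "adj G x y" for x y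
  proof (rule ccontr)
    assume notin: "y \<notin> insert x1 X"
    \<comment> \<open>A neighbour \<open>y\<close> of both \<open>x\<close> and \<open>x1\<close>
      would already be in \<open>X\<close>: if \<open>x\<close> is not \<open>x0\<close>, then
      \<open>y\<close> and \<open>x0\<close> are common neighbours of \<open>x\<close> and
      \<open>x1\<close>.\<close>
    have not1: "\<not> adj G y x1"
    proof
      assume y1: "adj G y x1"
      have "y \<noteq> x0"
        using notin x01 by (auto simp: X_def)
      have "adj G y x0"
      proof (cases "x = x0")
        case True
        then show ?thesis
          using y adj_sym[of G] by blast
      next
        case False
        then show ?thesis
          using K4_minus_free_adj[OF K G(1) \<open>y \<noteq> x0\<close>, of x x1] x y y1 x01 adj_sym[of G]
          by (auto simp: X_def)
      qed
      then show False
        using notin y1 by (simp add: X_def)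
    qed
    have "y \<notin> set (x # x1 # zs)"
    proof
      assume "y \<in> set (x # x1 # zs)"
      then have "y \<in> set zs"
        using notin irr[OF y] by auto
      then obtain k where "k < length zs" "y = zs ! k"
        by (metis in_set_conv_nth)
      then show False
        using path'(2)[OF x, of "Suc k"] y by simp
    qed
    moreover have "\<not> adj G y ((x # x1 # zs) ! k)" if "1 \<le> k" "k < length (x # x1 # zs)" for k
    proof (cases "k = 1")
      case False
      then have k2: "2 \<le> k"
        using that by simp
      have "adj G y ((x # x1 # zs) ! 0)" "\<not> adj G y ((x # x1 # zs) ! 1)"
        using y not1 adj_sym[of G] by simp_all
      then show ?thesis
        using chordal_induced_path_chord[OF G path'(3)[OF x] calculation] k2 that(2) by blast
    qed (use not1 in simp)
    \<comment> \<open>The longest path \<open>xs\<close> is \<open>x0 # x1 # zs\<close>, so this one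
      has one vertex more.\<close>
    ultimately have "induced_path G (y # x # x1 # zs)"
      using y adj_sym[of G] by (intro induced_path_Cons[OF G(1) path'(3)[OF x]]) auto
    then show False
      using longest[of "y # x # x1 # zs"] by (simp add: xs_eq)
  qed
  have "adj G x y" if "x \<in> X" "y \<in> X" "x \<noteq> y" for x y
    using that K4_minus_free_adj[OF K G(1), of x y x0 x1] x01 adj_sym[of G] by (auto simp: X_def)
  moreover have "adj G x x1" "adj G x1 x" if "x \<in> X" for x
    using that adj_sym[of G x1 x] by (simp_all add: X_def)
  ultimately have "clique (insert x1 X) (edges G)"
    unfolding clique_adj by blast
  moreover have "x0 \<in> X" "x1 \<notin> X" "X \<subseteq> verts G"
    using x01 inV irr[of x1 x1] irr[of x0 x1] by (auto simp: X_def)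
  ultimately show thesis
    using closed inV(2)[OF x01] by (intro that[of x1 X]) (auto simp del: insert_iff)
qed

section \<open>Extending contact representations\<close>

fun scale :: "int \<Rightarrow> grid_path \<Rightarrow> grid_path" where
  "scale k (Horizontal y a b) = Horizontal (k * y) (k * a) (k * b)"
| "scale k (Vertical x a b) = Vertical (k * x) (k * a) (k * b)"

fun scale_point :: "int \<Rightarrow> int \<times> int \<Rightarrow> int \<times> int" where
  "scale_point k (x, y) = (k * x, k * y)"

lemma positive_length_scale: "k > 0 \<Longrightarrow> positive_length (scale k P) \<longleftrightarrow> positive_length P"
  by (cases P) auto

lemma compatible_scale:
  assumes "k > 0" "positive_length P" "positive_length Q"
  shows "compatible (scale k P) (scale k Q) \<longleftrightarrow> compatible P Q"
  using assms by (cases P; cases Q) (auto simp: compatible_simps)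

lemma meets_scale:
  assumes "k > 0" "positive_length P" "positive_length Q"
  shows "meets (scale k P) (scale k Q) \<longleftrightarrow> meets P Q"
  using assms by (cases P; cases Q) (auto simp: meets_simps)

lemma scale_point_in_grid_points:
  "k > 0 \<Longrightarrow> scale_point k p \<in> grid_points (scale k P) \<longleftrightarrow> p \<in> grid_points P"
  by (cases P; cases p) auto

lemma ends_scale: "ends (scale k P) = scale_point k ` ends P"
  by (cases P) auto

lemma inj_scale_point: "k > 0 \<Longrightarrow> inj (scale_point k)"
  by (auto simp: inj_on_def)

section \<open>Free ends and their invariance under scaling\<close>

definition free_ends :: "'a graph \<Rightarrow> ('a \<Rightarrow> grid_path) \<Rightarrow> 'a \<Rightarrow> (int \<times> int) set" where
  "free_ends G P v = {p \<in> ends (P v). \<forall>u \<in> verts G - {v}. p \<notin> grid_points (P u)}"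

lemma finite_free_ends [simp]: "finite (free_ends G P v)"
  by (simp add: free_ends_def)

lemma free_ends_scale:
  assumes "k > 0"
  shows "free_ends G (\<lambda>v. scale k (P v)) v = scale_point k ` free_ends G P v"
proof -
  have "{q \<in> scale_point k ` A. R q} = scale_point k ` {p \<in> A. R (scale_point k p)}" for A R
    by blast
  then show ?thesis
    using assms by (simp add: free_ends_def ends_scale scale_point_in_grid_points)
qed

lemma card_free_ends_scale:
  "k > 0 \<Longrightarrow> card (free_ends G (\<lambda>v. scale k (P v)) v) = card (free_ends G P v)"
  by (simp add: free_ends_scale card_image inj_on_subset[OF inj_scale_point])

lemma contact_B0_VPG_rep_scale:
  assumes "k > 0" "contact_B0_VPG_rep G P"
  shows "contact_B0_VPG_rep G (\<lambda>v. scale k (P v))"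
  using assms unfolding contact_B0_VPG_rep_iff
  by (simp add: positive_length_scale compatible_scale meets_scale)

text \<open>After scaling by 3, a path meets the box around \<open>3p\<close> only if it contains \<open>p\<close>.\<close>

definition box :: "int \<times> int \<Rightarrow> (int \<times> int) set" where
  "box p = {3 * fst p - 1..3 * fst p + 1} \<times> {3 * snd p - 1..3 * snd p + 1}"

lemma scale_3_disjoint_box:
  assumes "positive_length P" "p \<notin> grid_points P"
  shows "grid_points (scale 3 P) \<inter> box p = {}"
proof -
  have "q \<notin> box p" if "q \<in> grid_points (scale 3 P)" for q
    using assms that by (cases P; cases p; cases q) (auto simp: box_def)
  then show ?thesis
    by blast
qed

text \<open>All new paths stay in the box around the scaled \<open>p\<close>, which only old paths
  through \<open>p\<close> enter. So no contact with any other old path arises, and a free end other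
  than \<open>p\<close> stays free.\<close>

lemma contact_rep_attach:
  assumes G: "simple_graph G" and X: "X \<subseteq> verts G" and P: "contact_B0_VPG_rep (induced_subgraph G (verts G - X)) P"
    and pos: "\<And>x. x \<in> X \<Longrightarrow> positive_length (N x)"
    and in_box: "\<And>x. x \<in> X \<Longrightarrow> grid_points (N x) \<subseteq> box p"
    and NN: "\<And>x y. x \<in> X \<Longrightarrow> y \<in> X \<Longrightarrow> x \<noteq> y \<Longrightarrow>
        compatible (N x) (N y) \<and> (adj G x y \<longleftrightarrow> meets (N x) (N y))"
    and NP: "\<And>x u. x \<in> X \<Longrightarrow> u \<in> verts G - X \<Longrightarrow> p \<in> grid_points (P u) \<Longrightarrow>
        compatible (N x) (scale 3 (P u)) \<and> adj G x u \<and> meets (N x) (scale 3 (P u))"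
    and non: "\<And>x u. x \<in> X \<Longrightarrow> u \<in> verts G - X \<Longrightarrow> p \<notin> grid_points (P u) \<Longrightarrow> \<not> adj G x u"
  defines "Q \<equiv> \<lambda>v. if v \<in> X then N v else scale 3 (P v)"
  shows "contact_B0_VPG_rep G Q"
    and "\<And>u. u \<in> verts G - X \<Longrightarrow>
      card (free_ends G Q u) \<ge> card (free_ends (induced_subgraph G (verts G - X)) P u - {p})"
    and "\<And>x. x \<in> X \<Longrightarrow> free_ends G Q x = {q \<in> ends (N x). (\<forall>y \<in> X - {x}. q \<notin> grid_points (N y)) \<and>
      (\<forall>u \<in> verts G - X. p \<in> grid_points (P u) \<longrightarrow> q \<notin> grid_points (scale 3 (P u)))}"
proof -
  let ?G = "induced_subgraph G (verts G - X)"
  have V: "verts ?G = verts G - X"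
    by auto
  note PD = contact_B0_VPG_repD[OF P, unfolded V]
  have far: "grid_points (N x) \<inter> grid_points (scale 3 (P u)) = {}"
    if "x \<in> X" "u \<in> verts G - X" "p \<notin> grid_points (P u)" for x u
    using scale_3_disjoint_box[OF PD(1) that(3)] in_box that by blast
  have inner: "interior_points R \<subseteq> grid_points R" for R
    by (cases R) auto
  have edges: "\<Union>(grid_edges R) \<subseteq> grid_points R" for R
    by (cases R) auto
  have nonempty: "{} \<notin> grid_edges R" for R
    by (cases R) auto
  \<comment> \<open>A grid edge is a nonempty set of points of its path, so a common edge would
    yield a common point.\<close>
  have compatible_far: "compatible R S" if "grid_points R \<inter> grid_points S = {}" for R S
  proof -
    have "e \<notin> grid_edges S" if e: "e \<in> grid_edges R" for e
    proof
      assume "e \<in> grid_edges S"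
      moreover obtain q where "q \<in> e"
        using e nonempty[of R] by (metis equals0I)
      ultimately show False
        using e \<open>_ = {}\<close> edges[of R] edges[of S] by blast
    qed
    then show ?thesis
      using inner[of R] inner[of S] that unfolding compatible_def by blast
  qed
  have XP: "compatible (N x) (scale 3 (P u)) \<and> (adj G x u \<longleftrightarrow> meets (N x) (scale 3 (P u)))"
    if "x \<in> X" "u \<in> verts G - X" for x u
  proof (cases "p \<in> grid_points (P u)")
    case True
    then show ?thesis
      using NP that by blast
  next
    case False
    then show ?thesis
      using far[OF that False] non[OF that False] compatible_far by (auto simp: meets_def)
  qed
  have PP: "compatible (scale 3 (P u)) (scale 3 (P v)) \<and>
      (adj G u v \<longleftrightarrow> meets (scale 3 (P u)) (scale 3 (P v)))"
    if "u \<in> verts G - X" "v \<in> verts G - X" "u \<noteq> v" for u v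
    using PD(2,3)[OF that] PD(1) that by (auto simp: compatible_scale meets_scale)
  show "contact_B0_VPG_rep G Q"
    unfolding contact_B0_VPG_rep_iff
  proof (intro conjI ballI impI)
    fix v assume "v \<in> verts G"
    then show "positive_length (Q v)"
      using pos PD(1) by (auto simp: Q_def positive_length_scale)
  next
    fix u v assume uv: "u \<in> verts G" "v \<in> verts G" "u \<noteq> v"
    show "compatible (Q u) (Q v)" "adj G u v \<longleftrightarrow> meets (Q u) (Q v)"
      using NN[of u v] XP[of u v] XP[of v u] PP[of u v] uv
        compatible_sym[of "Q u" "Q v"] meets_sym[of "Q u" "Q v"] adj_sym[of G u v]
      by (cases "u \<in> X"; cases "v \<in> X"; auto simp: Q_def)+
  qed
  show "card (free_ends G Q u) \<ge> card (free_ends ?G P u - {p})" if u: "u \<in> verts G - X" for u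
  proof -
    have "scale_point 3 ` (free_ends ?G P u - {p}) \<subseteq> free_ends G Q u"
    proof
      fix r assume "r \<in> scale_point 3 ` (free_ends ?G P u - {p})"
      then obtain q where q: "q \<in> free_ends ?G P u" "q \<noteq> p" "r = scale_point 3 q"
        by blast
      have "r \<notin> box p"
        using q(2,3) by (cases p; cases q) (auto simp: box_def)
      then have "r \<notin> grid_points (N x)" if "x \<in> X" for x
        using in_box that by blast
      then show "r \<in> free_ends G Q u"
        using q(1) u by (auto simp: q(3) free_ends_def Q_def ends_scale scale_point_in_grid_points)
    qed
    then have "card (scale_point 3 ` (free_ends ?G P u - {p})) \<le> card (free_ends G Q u)"
      by (intro card_mono) auto
    then show ?thesis
      by (simp add: card_image inj_on_subset[OF inj_scale_point])
  qed
  show "free_ends G Q x = {q \<in> ends (N x). (\<forall>y \<in> X - {x}. q \<notin> grid_points (N y)) \<and>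
      (\<forall>u \<in> verts G - X. p \<in> grid_points (P u) \<longrightarrow> q \<notin> grid_points (scale 3 (P u)))}"
    if x: "x \<in> X" for x
  proof -
    have "q \<notin> grid_points (scale 3 (P u))"
      if "q \<in> ends (N x)" "u \<in> verts G - X" "p \<notin> grid_points (P u)" for q u
      using far[OF x that(2,3)] that(1) ends_subset_grid_points[OF pos[OF x]] by blast
    note far_end = this
    show ?thesis
    proof (rule set_eqI)
      fix q
      show "q \<in> free_ends G Q x \<longleftrightarrow> q \<in> {q \<in> ends (N x). (\<forall>y \<in> X - {x}. q \<notin> grid_points (N y)) \<and>
        (\<forall>u \<in> verts G - X. p \<in> grid_points (P u) \<longrightarrow> q \<notin> grid_points (scale 3 (P u)))}"
        using x X far_end[of q] by (auto simp: free_ends_def Q_def)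
    qed
  qed
qed

text \<open>
  New paths \<open>N i\<close> for \<open>i < n\<close> that touch the path \<open>Q\<close> in \<open>p\<close> after scaling by 3. Both ends of the
  first \<open>m\<close> of them and at least one end of the others remain free.
\<close>

definition star :: "grid_path \<Rightarrow> int \<times> int \<Rightarrow> nat \<Rightarrow> nat \<Rightarrow> (nat \<Rightarrow> grid_path) \<Rightarrow> bool" where
  "star Q p m n N \<longleftrightarrow>
     (\<forall>i < n. positive_length (N i) \<and> grid_points (N i) \<subseteq> box p \<and>
        compatible (N i) (scale 3 Q) \<and> meets (N i) (scale 3 Q)) \<and>
     (\<forall>i < n. \<forall>j < n. i \<noteq> j \<longrightarrow> compatible (N i) (N j) \<and> meets (N i) (N j)) \<and>
     (\<forall>i < n. let free = (\<lambda>q. q \<notin> grid_points (scale 3 Q) \<and> (\<forall>j < n. j \<noteq> i \<longrightarrow> q \<notin> grid_points (N j)))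
        in (\<exists>q \<in> ends (N i). free q) \<and> (i < m \<longrightarrow> (\<forall>q \<in> ends (N i). free q)))"

text \<open>Unrolls bounded quantifiers, so that a star given as a list through \<open>(!)\<close>
  can be checked position by position.\<close>

lemma star_list_simps:
  "(\<forall>i < Suc n. R i) \<longleftrightarrow> R 0 \<and> (\<forall>i < n. R (Suc i))"
  using less_Suc_eq_0_disj by auto

text \<open>A path that ends at \<open>p\<close> leaves three directions there. Either three unit
  paths take one each, or a path perpendicular to \<open>Q\<close> passes through \<open>p\<close>,
  keeping both of its ends, and a unit path takes the direction opposite to
  \<open>Q\<close>.\<close>

lemma star_at_end:
  assumes "positive_length Q" "p \<in> ends Q"
  shows "\<exists>N. star Q p 0 3 N" and "\<exists>N. star Q p 1 2 N"
proof -
  obtain x y where p: "p = (x, y)"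
    by (cases p)
  let ?E = "Horizontal (3 * y) (3 * x) (3 * x + 1)" and ?W = "Horizontal (3 * y) (3 * x - 1) (3 * x)"
    and ?N = "Vertical (3 * x) (3 * y) (3 * y + 1)" and ?S = "Vertical (3 * x) (3 * y - 1) (3 * y)"
    and ?H = "Horizontal (3 * y) (3 * x - 1) (3 * x + 1)" and ?V = "Vertical (3 * x) (3 * y - 1) (3 * y + 1)"
  note simps = star_def p numeral_2_eq_2 numeral_3_eq_3 star_list_simps box_def compatible_simps meets_simps
    times_subset_iff
  \<comment> \<open>\<open>p\<close> is the left, right, lower or upper end of
    \<open>Q\<close>.\<close>
  have cases: thesis if "\<And>b. Q = Horizontal y x b \<Longrightarrow> x < b \<Longrightarrow> thesis" "\<And>a. Q = Horizontal y a x \<Longrightarrow> a < x \<Longrightarrow> thesis"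
    "\<And>b. Q = Vertical x y b \<Longrightarrow> y < b \<Longrightarrow> thesis" "\<And>a. Q = Vertical x a y \<Longrightarrow> a < y \<Longrightarrow> thesis" for thesis
    using assms that by (cases Q) (auto simp: p)
  from cases have "star Q p 0 3 ((!) [?W, ?N, ?S]) \<or> star Q p 0 3 ((!) [?E, ?N, ?S]) \<or>
      star Q p 0 3 ((!) [?E, ?W, ?S]) \<or> star Q p 0 3 ((!) [?E, ?W, ?N])"
  proof cases
    case 1
    then have "star Q p 0 3 ((!) [?W, ?N, ?S])"
      by (simp add: simps)
    then show ?thesis ..
  next
    case 2
    then have "star Q p 0 3 ((!) [?E, ?N, ?S])"
      by (simp add: simps)
    then show ?thesis by blast
  next
    case 3
    then have "star Q p 0 3 ((!) [?E, ?W, ?S])"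
      by (simp add: simps)
    then show ?thesis by blast
  next
    case 4
    then have "star Q p 0 3 ((!) [?E, ?W, ?N])"
      by (simp add: simps)
    then show ?thesis by blast
  qed
  then show "\<exists>N. star Q p 0 3 N"
    by blast
  from cases have "star Q p 1 2 ((!) [?V, ?W]) \<or> star Q p 1 2 ((!) [?V, ?E]) \<or>
      star Q p 1 2 ((!) [?H, ?S]) \<or> star Q p 1 2 ((!) [?H, ?N])"
  proof cases
    case 1
    then have "star Q p 1 2 ((!) [?V, ?W])"
      by (simp add: simps)
    then show ?thesis ..
  next
    case 2
    then have "star Q p 1 2 ((!) [?V, ?E])"
      by (simp add: simps)
    then show ?thesis by blast
  next
    case 3
    then have "star Q p 1 2 ((!) [?H, ?S])"
      by (simp add: simps)
    then show ?thesis by blast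
  next
    case 4
    then have "star Q p 1 2 ((!) [?H, ?N])"
      by (simp add: simps)
    then show ?thesis by blast
  qed
  then show "\<exists>N. star Q p 1 2 N"
    by blast
qed

text \<open>Here \<open>Q\<close> uses two opposite directions, and a unit path fits on either side
  of it.\<close>

lemma star_at_interior_point:
  assumes "p \<in> interior_points Q"
  shows "\<exists>N. star Q p 0 2 N"
proof -
  obtain x y where p: "p = (x, y)"
    by (cases p)
  note simps = star_def p numeral_2_eq_2 numeral_3_eq_3 star_list_simps box_def compatible_simps meets_simps
    times_subset_iff
  show ?thesis
  proof (cases Q)
    case (Horizontal z a b)
    then have "star Q p 0 2 ((!) [Vertical (3 * x) (3 * y) (3 * y + 1), Vertical (3 * x) (3 * y - 1) (3 * y)])"
      using assms by (simp add: simps)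
    then show ?thesis
      by blast
  next
    case (Vertical z a b)
    then have "star Q p 0 2 ((!) [Horizontal (3 * y) (3 * x) (3 * x + 1), Horizontal (3 * y) (3 * x - 1) (3 * x)])"
      using assms by (simp add: simps)
    then show ?thesis
      by blast
  qed
qed

text \<open>Doubling turns the midpoint of the first grid edge of \<open>Q\<close> into a grid
  point. Its odd coordinate keeps perpendicular paths away, and a parallel path through it would
  contain that grid edge.\<close>

lemma scale_2_private_interior_point:
  assumes "positive_length Q"
  obtains p where "p \<in> interior_points (scale 2 Q)"
    "\<And>R. positive_length R \<Longrightarrow> compatible Q R \<Longrightarrow> p \<notin> grid_points (scale 2 R)"
proof (cases Q)
  case (Horizontal y a b)
  have "(2 * a + 1, 2 * y) \<notin> grid_points (scale 2 R)" if "positive_length R" "compatible Q R" for R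
    using that assms Horizontal by (cases R) (auto simp: compatible_simps, presburger+)
  then show thesis
    using assms Horizontal by (intro that[of "(2 * a + 1, 2 * y)"]) auto
next
  case (Vertical x a b)
  have "(2 * x, 2 * a + 1) \<notin> grid_points (scale 2 R)" if "positive_length R" "compatible Q R" for R
    using that assms Vertical by (cases R) (auto simp: compatible_simps, presburger+)
  then show thesis
    using assms Vertical by (intro that[of "(2 * x, 2 * a + 1)"]) auto
qed

definition representable :: "'a graph \<Rightarrow> ('a \<Rightarrow> nat) \<Rightarrow> bool" where
  "representable G r \<longleftrightarrow>
     (\<exists>P. contact_B0_VPG_rep G P \<and> (\<forall>v \<in> verts G. r v \<le> card (free_ends G P v)))"

text \<open>Finitely many paths miss some grid point, and after scaling the box around it is empty.
  The path placed there keeps both ends free, which meets any demand up to 2.\<close>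

lemma representable_isolated:
  assumes G: "simple_graph G" and x: "x \<in> verts G" "\<And>y. \<not> adj G x y" and r: "r x \<le> 2"
    and rep: "representable (induced_subgraph G (verts G - {x})) r"
  shows "representable G r"
proof -
  let ?G = "induced_subgraph G (verts G - {x})"
  obtain P where P: "contact_B0_VPG_rep ?G P"
    and free: "\<And>v. v \<in> verts G - {x} \<Longrightarrow> r v \<le> card (free_ends ?G P v)"
    using rep unfolding representable_def by auto
  have "finite (grid_points R)" for R
    by (cases R) auto
  then have "finite (\<Union>v \<in> verts G. grid_points (P v))"
    using G by simp
  moreover have "infinite (UNIV :: (int \<times> int) set)"
    by (simp add: infinite_UNIV_char_0 finite_prod)
  ultimately obtain p where p: "p \<notin> (\<Union>v \<in> verts G. grid_points (P v))"
    using ex_new_if_finite by blast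
  define N where "N = Horizontal (3 * snd p) (3 * fst p - 1) (3 * fst p + 1)"
  let ?Q = "\<lambda>v. if v \<in> {x} then N else scale 3 (P v)"
  have N: "positive_length N" "grid_points N \<subseteq> box p"
    by (auto simp: N_def box_def)
  have none: "p \<notin> grid_points (P u)" if "u \<in> verts G" for u
    using p that by blast
  have attach: "contact_B0_VPG_rep G ?Q"
    "\<And>u. u \<in> verts G - {x} \<Longrightarrow> card (free_ends G ?Q u) \<ge> card (free_ends ?G P u - {p})"
    "free_ends G ?Q x = ends N"
    using contact_rep_attach[OF G _ P, of "\<lambda>_. N" p] N none x by auto
  have "r v \<le> card (free_ends G ?Q v)" if v: "v \<in> verts G" for v
  proof (cases "v = x")
    case True
    then show ?thesis
      using attach(3) card_ends[OF N(1)] r by simp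
  next
    case False
    then have "p \<notin> free_ends ?G P v"
      using none[OF v] ends_subset_grid_points contact_B0_VPG_repD(1)[OF P, of v] v
      by (auto simp: free_ends_def)
    then show ?thesis
      using attach(2)[of v] free[of v] False v by simp
  qed
  then show ?thesis
    using attach(1) unfolding representable_def by blast
qed

text \<open>\<open>v\<close> need not have neighbours outside \<open>X\<close>, so a complete
  component with at least two vertices also counts.\<close>

definition leaf_block :: "'a graph \<Rightarrow> 'a \<Rightarrow> 'a set \<Rightarrow> bool" where
  "leaf_block G v X \<longleftrightarrow> v \<in> verts G \<and> X \<noteq> {} \<and> X \<subseteq> verts G \<and> v \<notin> X \<and> clique (insert v X) (edges G) \<and>
     (\<forall>x \<in> X. \<forall>y. adj G x y \<longrightarrow> y \<in> insert v X)"

text \<open>\<open>f\<close> assigns the vertices of \<open>X\<close> to the paths of the star; one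
  that needs both ends must get one of the first \<open>m\<close> positions. As no other old path
  contains \<open>p\<close>, the star touches \<open>v\<close> alone.\<close>

lemma representable_attach_leaf_block:
  assumes G: "simple_graph G" and leaf: "leaf_block G v X"
    and P: "contact_B0_VPG_rep (induced_subgraph G (verts G - X)) P"
    and p: "p \<in> grid_points (P v)" "\<And>u. u \<in> verts G - X \<Longrightarrow> u \<noteq> v \<Longrightarrow> p \<notin> grid_points (P u)"
    and star: "star (P v) p m n N" and idx: "inj_on f X" "f ` X \<subseteq> {..<n}"
    and free_X: "\<And>x. x \<in> X \<Longrightarrow> r x \<le> (if f x < m then 2 else 1)"
    and free: "\<And>u. u \<in> verts G - X \<Longrightarrow> r u \<le> card (free_ends (induced_subgraph G (verts G - X)) P u - {p})"
  shows "representable G r"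
proof -
  let ?Q = "\<lambda>u. if u \<in> X then N (f u) else scale 3 (P u)"
  have v: "v \<in> verts G - X" and X: "X \<subseteq> verts G" and cl: "\<And>x y. x \<in> insert v X \<Longrightarrow> y \<in> insert v X \<Longrightarrow> x \<noteq> y \<Longrightarrow> adj G x y"
    and closed: "\<And>x y. x \<in> X \<Longrightarrow> adj G x y \<Longrightarrow> y \<in> insert v X"
    using leaf unfolding leaf_block_def clique_adj by blast+
  have only_v: "u = v" if "u \<in> verts G - X" "p \<in> grid_points (P u)" for u
    using p(2) that by blast
  have f: "f x < n" "f x = f y \<longleftrightarrow> x = y" if "x \<in> X" "y \<in> X" for x y
    using idx that by (auto simp: inj_on_def)
  have N: "positive_length (N i)" "grid_points (N i) \<subseteq> box p" "compatible (N i) (scale 3 (P v))"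
    "meets (N i) (scale 3 (P v))" if "i < n" for i
    using star that unfolding star_def by blast+
  have NN: "compatible (N i) (N j)" "meets (N i) (N j)" if "i < n" "j < n" "i \<noteq> j" for i j
    using star that unfolding star_def by blast+
  have pos: "positive_length (N (f x))" and in_box: "grid_points (N (f x)) \<subseteq> box p" if "x \<in> X" for x
    using N f[OF that that] by blast+
  have NfNf: "compatible (N (f x)) (N (f y)) \<and> (adj G x y \<longleftrightarrow> meets (N (f x)) (N (f y)))"
    if "x \<in> X" "y \<in> X" "x \<noteq> y" for x y
    using NN[of "f x" "f y"] f[of x y] f[of y x] cl[of x y] that by blast
  have NfP: "compatible (N (f x)) (scale 3 (P u)) \<and> adj G x u \<and> meets (N (f x)) (scale 3 (P u))"
    if "x \<in> X" "u \<in> verts G - X" "p \<in> grid_points (P u)" for x u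
    using only_v[OF that(2,3)] N[of "f x"] f[OF that(1,1)] cl[of x v] v that(1) by blast
  have non: "\<not> adj G x u" if "x \<in> X" "u \<in> verts G - X" "p \<notin> grid_points (P u)" for x u
    using closed[OF that(1)] that(2,3) p(1) by blast
  have attach: "contact_B0_VPG_rep G ?Q"
    "\<And>u. u \<in> verts G - X \<Longrightarrow>
      card (free_ends G ?Q u) \<ge> card (free_ends (induced_subgraph G (verts G - X)) P u - {p})"
    "\<And>x. x \<in> X \<Longrightarrow> free_ends G ?Q x = {q \<in> ends (N (f x)). (\<forall>y \<in> X - {x}. q \<notin> grid_points (N (f y))) \<and>
      (\<forall>u \<in> verts G - X. p \<in> grid_points (P u) \<longrightarrow> q \<notin> grid_points (scale 3 (P u)))}"
    by (rule contact_rep_attach[OF G X P]; (rule pos in_box NfNf NfP non)?; assumption)+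
  have "r u \<le> card (free_ends G ?Q u)" if u: "u \<in> verts G" for u
  proof (cases "u \<in> X")
    case True
    let ?free = "\<lambda>q. q \<notin> grid_points (scale 3 (P v)) \<and> (\<forall>j < n. j \<noteq> f u \<longrightarrow> q \<notin> grid_points (N j))"
    have fu: "f u < n"
      using f True by blast
    have sub: "{q \<in> ends (N (f u)). ?free q} \<subseteq> free_ends G ?Q u"
      unfolding attach(3)[OF True] using only_v f True by blast
    have st: "(\<exists>q \<in> ends (N (f u)). ?free q) \<and> (f u < m \<longrightarrow> (\<forall>q \<in> ends (N (f u)). ?free q))"
      using star fu unfolding star_def Let_def by blast
    show ?thesis
    proof (cases "f u < m")
      case less: True
      then have "ends (N (f u)) \<subseteq> free_ends G ?Q u"
        using st sub by blast
      then have "card (ends (N (f u))) \<le> card (free_ends G ?Q u)"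
        by (intro card_mono) auto
      then show ?thesis
        using card_ends[OF pos[OF True]] free_X[OF True] less by simp
    next
      case False
      have "free_ends G ?Q u \<noteq> {}"
        using st sub by blast
      then have "card (free_ends G ?Q u) > 0"
        by (simp add: card_gt_0_iff)
      then show ?thesis
        using free_X[OF True] False by simp
    qed
  next
    case False
    then show ?thesis
      using attach(2)[of u] free[of u] u by fastforce
  qed
  then show ?thesis
    using attach(1) unfolding representable_def by blast
qed

section \<open>Extending obstructions\<close>

lemma leaf_block_adj:
  "leaf_block G v X \<Longrightarrow> x \<in> insert v X \<Longrightarrow> y \<in> insert v X \<Longrightarrow> x \<noteq> y \<Longrightarrow> adj G x y"
  unfolding leaf_block_def clique_adj by blast

lemma obstructionD:
  assumes "obstruction G r T \<D> \<rho>"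
  shows "T \<subseteq> verts G" "\<Union>\<D> \<subseteq> verts G" "T \<inter> \<Union>\<D> = {}" "is_tree (induced_subgraph G T)"
    and "\<forall>D \<in> \<D>. card D = 3 \<and> clique D (edges G)"
    and "\<forall>D \<in> \<D>. \<forall>D' \<in> \<D>. D \<noteq> D' \<longrightarrow> D \<inter> D' = {} \<and> anticomplete_to G D D'"
    and "\<forall>D \<in> \<D>. \<exists>v \<in> T. complete_to G D {v} \<and> anticomplete_to G D (T - {v})"
    and "\<forall>v \<in> T. \<rho> v \<le> r v \<and>
      degree (induced_subgraph G T) v + card {D \<in> \<D>. complete_to G {v} D} + \<rho> v = 3"
  using assms unfolding obstruction_def by simp_all

text \<open>An obstruction speaks only about adjacencies among its own vertices, and these do not
  change in the larger graph. The inclusions in \<open>S\<close> keep it away from the removed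
  vertices.\<close>

lemma obstruction_induced_subgraph:
  assumes "obstruction (induced_subgraph G S) r T \<D> \<rho>"
  shows "obstruction G r T \<D> \<rho>" "T \<subseteq> S" "\<Union>\<D> \<subseteq> S"
proof -
  have "T \<subseteq> verts G \<inter> S" "\<Union>\<D> \<subseteq> verts G \<inter> S"
    using obstructionD(1,2)[OF assms] by simp_all
  then show T: "T \<subseteq> S" and D: "\<Union>\<D> \<subseteq> S"
    by blast+
  have ind: "induced_subgraph G (S \<inter> T) = induced_subgraph G T"
    using T by (simp add: Int_absorb1)
  have "clique A (edges (induced_subgraph G S)) \<longleftrightarrow> clique A (edges G)" if "A \<subseteq> S" for A
    using that unfolding clique_adj by (auto simp: subset_iff)
  then have cl: "clique A (edges (induced_subgraph G S)) \<longleftrightarrow> clique A (edges G)" if "A \<in> \<D>" for A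
    using that D by blast
  have anti: "anticomplete_to (induced_subgraph G S) A B \<longleftrightarrow> anticomplete_to G A B"
    if "A \<subseteq> S" "B \<subseteq> S" for A B
    using that by (auto simp: anticomplete_to_def subset_iff)
  have comp: "complete_to (induced_subgraph G S) A B \<longleftrightarrow> complete_to G A B"
    if "A \<subseteq> S" "B \<subseteq> S" for A B
    using that by (auto simp: complete_to_def subset_iff)
  have DS: "A \<subseteq> S" if "A \<in> \<D>" for A
    using that D by blast
  have set: "{A \<in> \<D>. complete_to (induced_subgraph G S) {v} A} = {A \<in> \<D>. complete_to G {v} A}"
    if "v \<in> T" for v
    using that T DS by (intro Collect_cong conj_cong refl comp) auto
  have TS: "T - {v} \<subseteq> S" for v
    using T by blast
  have ob: "T \<subseteq> verts G \<inter> S" "\<Union>\<D> \<subseteq> verts G \<inter> S" "T \<inter> \<Union>\<D> = {}" "is_tree (induced_subgraph G T)"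
    "\<forall>A \<in> \<D>. card A = 3 \<and> clique A (edges (induced_subgraph G S))"
    "\<forall>A \<in> \<D>. \<forall>B \<in> \<D>. A \<noteq> B \<longrightarrow> A \<inter> B = {} \<and> anticomplete_to (induced_subgraph G S) A B"
    "\<forall>A \<in> \<D>. \<exists>v \<in> T. complete_to (induced_subgraph G S) A {v} \<and>
      anticomplete_to (induced_subgraph G S) A (T - {v})"
    "\<forall>v \<in> T. \<rho> v \<le> r v \<and> degree (induced_subgraph G T) v +
      card {A \<in> \<D>. complete_to (induced_subgraph G S) {v} A} + \<rho> v = 3"
    using obstructionD[OF assms] unfolding induced_subgraph_induced_subgraph ind verts_induced_subgraph .
  have 1: "T \<subseteq> verts G" "\<Union>\<D> \<subseteq> verts G"
    using ob(1,2) by blast+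
  have 2: "\<forall>A \<in> \<D>. card A = 3 \<and> clique A (edges G)"
    using ob(5) cl by simp
  have 3: "\<forall>A \<in> \<D>. \<forall>B \<in> \<D>. A \<noteq> B \<longrightarrow> A \<inter> B = {} \<and> anticomplete_to G A B"
    using ob(6) anti DS by simp
  have 4: "\<forall>A \<in> \<D>. \<exists>v \<in> T. complete_to G A {v} \<and> anticomplete_to G A (T - {v})"
  proof
    fix A assume A: "A \<in> \<D>"
    then obtain v where v: "v \<in> T" "complete_to (induced_subgraph G S) A {v}"
        "anticomplete_to (induced_subgraph G S) A (T - {v})"
      using bspec[OF ob(7) A] by blast
    then show "\<exists>v \<in> T. complete_to G A {v} \<and> anticomplete_to G A (T - {v})"
      using comp[OF DS[OF A], of "{v}"] anti[OF DS[OF A] TS[of v]] T by blast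
  qed
  have 5: "\<forall>v \<in> T. \<rho> v \<le> r v \<and>
      degree (induced_subgraph G T) v + card {A \<in> \<D>. complete_to G {v} A} + \<rho> v = 3"
    using ob(8) by (simp add: set)
  show "obstruction G r T \<D> \<rho>"
    unfolding obstruction_def using 1 2 3 4 5 ob(3,4) by (intro conjI)
qed

lemma obstructed_induced_subgraph: "obstructed (induced_subgraph G S) r \<Longrightarrow> obstructed G r"
  unfolding obstructed_def using obstruction_induced_subgraph(1) by blast

lemma degree_induced_subgraph:
  "v \<in> T \<Longrightarrow> T \<subseteq> verts G \<Longrightarrow> degree (induced_subgraph G T) v = card {u \<in> T. adj G v u}"
  unfolding degree_def by (rule arg_cong[where f = card]) auto

text \<open>No path has three ends: a one-vertex tree without triangles, where \<open>\<rho>\<close>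
  alone supplies the 3.\<close>

lemma obstructed_demand_3:
  assumes G: "simple_graph G" and x: "x \<in> verts G" "r x \<ge> 3"
  shows "obstructed G r"
proof -
  have "{u \<in> {x}. adj G x u} = {}"
    using simple_graphD(3)[OF G] by auto
  then have "obstruction G r {x} {} (\<lambda>_. 3)"
    using is_tree_singleton[OF G x(1)] x unfolding obstruction_def
    by (simp add: degree_induced_subgraph)
  then show ?thesis
    unfolding obstructed_def by blast
qed

text \<open>The tree is \<open>x\<close> alone, and the other vertices of the K4 form its triangle:
  0 + 1 + 2 = 3.\<close>

lemma obstructed_K4:
  assumes G: "simple_graph G" and leaf: "leaf_block G v X" and X: "card X = 3" "x \<in> X" "r x \<ge> 2"
  shows "obstructed G r"
proof -
  let ?D = "insert v (X - {x})"
  have lf: "v \<in> verts G" "X \<subseteq> verts G" "v \<notin> X" "clique (insert v X) (edges G)"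
    using leaf unfolding leaf_block_def by blast+
  have "{u \<in> {x}. adj G x u} = {}"
    using simple_graphD(3)[OF G] by auto
  moreover have "finite X"
    using X(1) by (metis card.infinite zero_neq_numeral)
  then have "card ?D = 3"
    using lf(3) X by (simp add: card_insert_if)
  moreover have comp: "complete_to G ?D {x}" "complete_to G {x} ?D"
    using lf(3) X(2) by (auto simp: complete_to_def intro!: leaf_block_adj[OF leaf])
  moreover have "clique ?D (edges G)"
    using lf(4) unfolding clique_adj by blast
  moreover have "{D \<in> {?D}. complete_to G {x} D} = {?D}"
    using comp by auto
  moreover have "anticomplete_to G ?D ({x} - {x})"
    by (simp add: anticomplete_to_def)
  moreover have "?D \<subseteq> verts G" "x \<in> verts G" "x \<notin> ?D"
    using lf X by auto
  ultimately have "obstruction G r {x} {?D} (\<lambda>_. 2)"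
    using is_tree_singleton[OF G, of x] X(3) unfolding obstruction_def
    by (simp add: degree_induced_subgraph)
  then show ?thesis
    unfolding obstructed_def by blast
qed

text \<open>Both paths would have to pass through their contact point. As an obstruction, each end
  of the tree edge contributes 1 + 0 + 2 = 3.\<close>

lemma obstructed_edge:
  assumes G: "simple_graph G" and xy: "adj G x y" "r x \<ge> 2" "r y \<ge> 2"
  shows "obstructed G r"
proof -
  note V = simple_graphD[OF G xy(1)]
  have yx: "adj G y x" and irr: "\<not> adj G x x" "\<not> adj G y y"
    using xy(1) adj_sym[of G] simple_graphD(3)[OF G] by blast+
  have "{u \<in> {y, x}. adj G x u} = {y}" "{u \<in> {y, x}. adj G y u} = {x}"
    using xy(1) yx irr by auto
  moreover have "is_tree (induced_subgraph G {y, x})"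
    using V xy(1) by (intro is_tree_insert_leaf[OF G is_tree_singleton[OF G, of x]]) auto
  ultimately have "obstruction G r {y, x} {} (\<lambda>_. 2)"
    using xy V unfolding obstruction_def by (simp add: degree_induced_subgraph)
  then show ?thesis
    unfolding obstructed_def by blast
qed

lemma obstruction_finite_triangles:
  assumes "simple_graph G" "obstruction G r T \<D> \<rho>"
  shows "finite \<D>"
proof -
  have "\<Union>\<D> \<subseteq> verts G"
    using assms(2) by (simp add: obstruction_def)
  then show ?thesis
    using assms(1) by (meson finite_UnionD finite_subset finite_verts)
qed

text \<open>Where the obstruction relies on the unit of demand added at \<open>v\<close>, the
  triangle \<open>X\<close> replaces it: one more triangle at \<open>v\<close>, one less in
  \<open>\<rho> v\<close>.\<close>

lemma obstructed_via_K4: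
  assumes G: "simple_graph G" and leaf: "leaf_block G v X" and X: "card X = 3"
    and obs: "obstructed (induced_subgraph G (verts G - X)) (r(v := Suc (r v)))"
  shows "obstructed G r"
proof -
  obtain T \<D> \<rho> where ob': "obstruction (induced_subgraph G (verts G - X)) (r(v := Suc (r v))) T \<D> \<rho>"
    using obs unfolding obstructed_def by blast
  note ob = obstruction_induced_subgraph(1)[OF ob']
  have TX: "T \<inter> X = {}" and DX: "\<Union>\<D> \<inter> X = {}"
    using obstruction_induced_subgraph(2,3)[OF ob'] by blast+
  show ?thesis
  proof (cases "v \<in> T \<and> \<rho> v = Suc (r v)")
    case False
    then have "obstruction G r T \<D> \<rho>"
      using ob unfolding obstruction_def by (auto simp: le_Suc_eq split: if_splits)
    then show ?thesis
      unfolding obstructed_def by blast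
  next
    case True
    have lf: "v \<in> verts G" "X \<subseteq> verts G" "X \<noteq> {}" "v \<notin> X" "clique (insert v X) (edges G)"
      and closed: "\<And>x y. x \<in> X \<Longrightarrow> adj G x y \<Longrightarrow> y \<in> insert v X"
      using leaf unfolding leaf_block_def by blast+
    have T: "T \<subseteq> verts G" "\<Union>\<D> \<subseteq> verts G" "T \<inter> \<Union>\<D> = {}" "is_tree (induced_subgraph G T)"
      and D: "\<forall>D \<in> \<D>. card D = 3 \<and> clique D (edges G)"
      and DD: "\<forall>D \<in> \<D>. \<forall>D' \<in> \<D>. D \<noteq> D' \<longrightarrow> D \<inter> D' = {} \<and> anticomplete_to G D D'"
      and DT: "\<forall>D \<in> \<D>. \<exists>v \<in> T. complete_to G D {v} \<and> anticomplete_to G D (T - {v})"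
      and deg: "\<forall>w \<in> T. \<rho> w \<le> (r(v := Suc (r v))) w \<and>
        degree (induced_subgraph G T) w + card {D \<in> \<D>. complete_to G {w} D} + \<rho> w = 3"
      using obstructionD[OF ob] .
    have anti: "\<not> adj G x y" "\<not> adj G y x" if "x \<in> X" "y \<in> (T - {v}) \<union> \<Union>\<D>" for x y
      using closed[OF that(1), of y] that(2) TX DX True T(3) adj_sym[of G x y] by blast+
    have vX: "adj G v x" "adj G x v" if "x \<in> X" for x
      using lf(4) that by (auto intro!: leaf_block_adj[OF leaf])
    have "X \<notin> \<D>"
      using DX lf(3) by blast
    have "{D \<in> insert X \<D>. complete_to G {v} D} = insert X {D \<in> \<D>. complete_to G {v} D}"
      using vX by (auto simp: complete_to_def)
    then have card_v: "card {D \<in> insert X \<D>. complete_to G {v} D} = Suc (card {D \<in> \<D>. complete_to G {v} D})"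
      using obstruction_finite_triangles[OF G ob] \<open>X \<notin> \<D>\<close> by simp
    have "{D \<in> insert X \<D>. complete_to G {w} D} = {D \<in> \<D>. complete_to G {w} D}" if "w \<in> T" "w \<noteq> v" for w
      using anti[of _ w] that lf(3) by (auto simp: complete_to_def)
    then have "\<forall>w \<in> T. (\<rho>(v := r v)) w \<le> r w \<and>
        degree (induced_subgraph G T) w + card {D \<in> insert X \<D>. complete_to G {w} D} + (\<rho>(v := r v)) w = 3"
      using deg card_v True by auto
    moreover have "\<forall>D \<in> insert X \<D>. card D = 3 \<and> clique D (edges G)"
      using D X lf(5) unfolding clique_adj by blast
    moreover have "\<forall>D \<in> insert X \<D>. \<forall>D' \<in> insert X \<D>. D \<noteq> D' \<longrightarrow> D \<inter> D' = {} \<and> anticomplete_to G D D'"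
    proof -
      have "X \<inter> D = {}" if "D \<in> \<D>" for D
        using that DX by blast
      moreover have "anticomplete_to G X D" "anticomplete_to G D X" if "D \<in> \<D>" for D
        using anti UnionI[OF that] unfolding anticomplete_to_def by blast+
      ultimately show ?thesis
        using DD by (simp add: Int_commute)
    qed
    moreover have "\<forall>D \<in> insert X \<D>. \<exists>v \<in> T. complete_to G D {v} \<and> anticomplete_to G D (T - {v})"
    proof -
      have "complete_to G X {v}" "anticomplete_to G X (T - {v})"
        using vX(2) anti(1) by (simp_all add: complete_to_def anticomplete_to_def)
      then show ?thesis
        using DT True by (simp only: ball_simps(7)) blast
    qed
    moreover have "\<Union>(insert X \<D>) \<subseteq> verts G" "T \<inter> \<Union>(insert X \<D>) = {}"
      using T(2,3) lf(2) TX by auto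
    ultimately have "obstruction G r T (insert X \<D>) (\<rho>(v := r v))"
      using T(1,4) unfolding obstruction_def by (intro conjI)
    then show ?thesis
      unfolding obstructed_def by blast
  qed
qed

text \<open>The unit of demand added at \<open>v\<close> is replaced by a tree edge to
  \<open>x\<close>. The new leaf balances by itself: 1 + 0 + 2 = 3.\<close>

lemma obstructed_via_edge:
  assumes G: "simple_graph G" and leaf: "leaf_block G v X" and x: "x \<in> X" "r x \<ge> 2"
    and obs: "obstructed (induced_subgraph G (verts G - X)) (r(v := Suc (r v)))"
  shows "obstructed G r"
proof -
  obtain T \<D> \<rho> where ob': "obstruction (induced_subgraph G (verts G - X)) (r(v := Suc (r v))) T \<D> \<rho>"
    using obs unfolding obstructed_def by blast
  note ob = obstruction_induced_subgraph(1)[OF ob']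
  have TX: "T \<inter> X = {}" and DX: "\<Union>\<D> \<inter> X = {}"
    using obstruction_induced_subgraph(2,3)[OF ob'] by blast+
  show ?thesis
  proof (cases "v \<in> T \<and> \<rho> v = Suc (r v)")
    case False
    then have "obstruction G r T \<D> \<rho>"
      using ob unfolding obstruction_def by (auto simp: le_Suc_eq split: if_splits)
    then show ?thesis
      unfolding obstructed_def by blast
  next
    case True
    have lf: "v \<in> verts G" "X \<subseteq> verts G" "v \<notin> X" "clique (insert v X) (edges G)"
      and closed: "\<And>x y. x \<in> X \<Longrightarrow> adj G x y \<Longrightarrow> y \<in> insert v X"
      using leaf unfolding leaf_block_def by blast+
    have T: "T \<subseteq> verts G" "\<Union>\<D> \<subseteq> verts G" "T \<inter> \<Union>\<D> = {}" "is_tree (induced_subgraph G T)"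
      and D: "\<forall>D \<in> \<D>. card D = 3 \<and> clique D (edges G)"
      and DD: "\<forall>D \<in> \<D>. \<forall>D' \<in> \<D>. D \<noteq> D' \<longrightarrow> D \<inter> D' = {} \<and> anticomplete_to G D D'"
      and DT: "\<forall>D \<in> \<D>. \<exists>v \<in> T. complete_to G D {v} \<and> anticomplete_to G D (T - {v})"
      and deg: "\<forall>w \<in> T. \<rho> w \<le> (r(v := Suc (r v))) w \<and>
        degree (induced_subgraph G T) w + card {D \<in> \<D>. complete_to G {w} D} + \<rho> w = 3"
      using obstructionD[OF ob] .
    have xT: "x \<notin> T" "x \<notin> \<Union>\<D>" "x \<noteq> v" "x \<in> verts G" "insert x T \<subseteq> verts G"
      using x TX DX lf T(1) by blast+
    have anti: "\<not> adj G x y" "\<not> adj G y x" if "y \<in> (T - {v}) \<union> \<Union>\<D>" for y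
      using closed[OF x(1), of y] that TX DX True T(3) adj_sym[of G x y] by blast+
    have vx: "adj G v x" "adj G x v" "\<not> adj G x x"
      using lf(3) x simple_graphD(3)[OF G] by (auto intro!: leaf_block_adj[OF leaf])
    have tree: "is_tree (induced_subgraph G (insert x T))"
      using T(1,4) True xT(1) vx(1) anti by (intro is_tree_insert_leaf[OF G, of T v]) auto
    have fin: "finite {u \<in> T. adj G w u}" for w
      using T(1) G by (auto intro: finite_subset)
    let ?N = "\<lambda>w. {u \<in> insert x T. adj G w u}"
    have "?N v = insert x {u \<in> T. adj G v u}"
      using vx by auto
    then have deg_v: "card (?N v) = Suc (card {u \<in> T. adj G v u})"
      using fin xT(1) by simp
    have "?N x = {v}"
      using vx anti True by auto
    then have deg_x: "card (?N x) = 1"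
      by simp
    have deg_w: "?N w = {u \<in> T. adj G w u}" if "w \<in> T" "w \<noteq> v" for w
      using anti that by auto
    have tri_x: "{D \<in> \<D>. complete_to G {x} D} = {}"
    proof -
      have "\<not> complete_to G {x} A" if "A \<in> \<D>" for A
      proof -
        have "A \<noteq> {}"
          using D that by force
        then obtain y where "y \<in> A"
          by blast
        then show ?thesis
          using anti(1)[of y] that by (auto simp: complete_to_def)
      qed
      then show ?thesis
        by blast
    qed
    \<comment> \<open>\<open>v\<close> gives up the extra unit because its degree grew by one; the
      leaf \<open>x\<close> brings in two units of its own demand.\<close>
    let ?\<rho> = "\<rho>(v := r v, x := 2)"
    have "?\<rho> w \<le> r w \<and> degree (induced_subgraph G (insert x T)) w + card {D \<in> \<D>. complete_to G {w} D} + ?\<rho> w = 3"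
      if w: "w \<in> insert x T" for w
    proof -
      have deg_eq: "degree (induced_subgraph G (insert x T)) w = card (?N w)"
        using w xT(5) by (rule degree_induced_subgraph)
      consider "w = x" | "w = v" | "w \<in> T" "w \<noteq> v" "w \<noteq> x"
        using w by blast
      then show ?thesis
      proof cases
        case 1
        then show ?thesis
          using deg_x tri_x x(2) xT(3) unfolding deg_eq by (simp only: card.empty) simp
      next
        case 2
        then show ?thesis
          using deg_v True xT(3) bspec[OF deg, of v] T(1) unfolding deg_eq
          by (simp add: degree_induced_subgraph)
      next
        case 3
        then show ?thesis
          using deg_w[of w] bspec[OF deg, of w] T(1) unfolding deg_eq
          by (simp add: degree_induced_subgraph)
      qed
    qed
    then have "\<forall>w \<in> insert x T. ?\<rho> w \<le> r w \<and>
        degree (induced_subgraph G (insert x T)) w + card {D \<in> \<D>. complete_to G {w} D} + ?\<rho> w = 3"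
      by (rule ballI)
    moreover have "\<forall>A \<in> \<D>. \<exists>w \<in> insert x T. complete_to G A {w} \<and> anticomplete_to G A (insert x T - {w})"
    proof
      fix A assume A: "A \<in> \<D>"
      then obtain w where w: "w \<in> T" "complete_to G A {w}" "anticomplete_to G A (T - {w})"
        using DT by blast
      moreover have "\<not> adj G a x" if "a \<in> A" for a
        using anti(2)[of a] that A by blast
      ultimately have "anticomplete_to G A (insert x T - {w})"
        unfolding anticomplete_to_def by blast
      then show "\<exists>w \<in> insert x T. complete_to G A {w} \<and> anticomplete_to G A (insert x T - {w})"
        using w by blast
    qed
    moreover have "insert x T \<inter> \<Union>\<D> = {}"
      using T(3) xT(2) by blast
    ultimately have "obstruction G r (insert x T) \<D> ?\<rho>"
      using T(2) xT(5) D DD tree unfolding obstruction_def by (intro conjI)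
    then show ?thesis
      unfolding obstructed_def by blast
  qed
qed

section \<open>Representability of chordal graphs\<close>

text \<open>The raised demand guarantees \<open>v\<close> one free end \<open>p\<close> to spare.
  Hanging the block there leaves \<open>r v\<close> free ends, and nobody else loses one, as
  \<open>p\<close> is on no other path.\<close>

lemma representable_leaf_end:
  assumes G: "simple_graph G" and leaf: "leaf_block G v X"
    and star: "\<And>Q p. positive_length Q \<Longrightarrow> p \<in> ends Q \<Longrightarrow> \<exists>N. star Q p m n N"
    and idx: "inj_on f X" "f ` X \<subseteq> {..<n}"
    and free_X: "\<And>x. x \<in> X \<Longrightarrow> r x \<le> (if f x < m then 2 else 1)"
    and rep: "representable (induced_subgraph G (verts G - X)) (r(v := Suc (r v)))"
  shows "representable G r"
proof -
  let ?G = "induced_subgraph G (verts G - X)"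
  obtain P where P: "contact_B0_VPG_rep ?G P"
    and free: "\<And>u. u \<in> verts G - X \<Longrightarrow> (r(v := Suc (r v))) u \<le> card (free_ends ?G P u)"
    using rep unfolding representable_def by auto
  have v: "v \<in> verts G - X"
    using leaf unfolding leaf_block_def by blast
  have pos: "positive_length (P u)" if "u \<in> verts G - X" for u
    using contact_B0_VPG_repD(1)[OF P, of u] that by simp
  have "card (free_ends ?G P v) > 0"
    using free[OF v] by simp
  then obtain p where p: "p \<in> free_ends ?G P v"
    by (metis card_gt_0_iff ex_in_conv)
  then have p_end: "p \<in> ends (P v)" and p_only: "\<And>u. u \<in> verts G - X \<Longrightarrow> u \<noteq> v \<Longrightarrow> p \<notin> grid_points (P u)"
    by (auto simp: free_ends_def)
  obtain N where N: "star (P v) p m n N"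
    using star[OF pos[OF v] p_end] by blast
  have "r u \<le> card (free_ends ?G P u - {p})" if u: "u \<in> verts G - X" for u
  proof (cases "u = v")
    case True
    then show ?thesis
      using free[OF u] p by simp
  next
    case False
    then have "p \<notin> free_ends ?G P u"
      using p_only[OF u False] ends_subset_grid_points[OF pos[OF u]] by (auto simp: free_ends_def)
    then show ?thesis
      using free[OF u] False by simp
  qed
  then show ?thesis
    using representable_attach_leaf_block[OF G leaf P _ p_only N idx free_X]
      p_end ends_subset_grid_points[OF pos[OF v]] by blast
qed

text \<open>Doubling gives \<open>v\<close> an interior point that is on no other path. It is
  nobody's end, so attaching a path on either side costs no free end.\<close>

lemma representable_leaf_interior:
  assumes G: "simple_graph G" and leaf: "leaf_block G v X" and X: "card X \<le> 2"
    and free_X: "\<And>x. x \<in> X \<Longrightarrow> r x \<le> 1"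
    and rep: "representable (induced_subgraph G (verts G - X)) r"
  shows "representable G r"
proof -
  let ?G = "induced_subgraph G (verts G - X)"
  obtain P' where P': "contact_B0_VPG_rep ?G P'"
    and free': "\<And>u. u \<in> verts G - X \<Longrightarrow> r u \<le> card (free_ends ?G P' u)"
    using rep unfolding representable_def by auto
  define P where "P u = scale 2 (P' u)" for u
  have P: "contact_B0_VPG_rep ?G P"
    using contact_B0_VPG_rep_scale[OF _ P', of 2] by (simp add: P_def[abs_def])
  have free: "r u \<le> card (free_ends ?G P u)" if "u \<in> verts G - X" for u
    using free'[OF that] card_free_ends_scale[of 2 ?G P' u] by (simp add: P_def[abs_def])
  have v: "v \<in> verts G - X" and finX: "finite X"
    using leaf G unfolding leaf_block_def by (auto intro: finite_subset)
  note PD = contact_B0_VPG_repD[OF P']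
  obtain p where p: "p \<in> interior_points (P v)"
    "\<And>R. positive_length R \<Longrightarrow> compatible (P' v) R \<Longrightarrow> p \<notin> grid_points (scale 2 R)"
    using scale_2_private_interior_point[of "P' v"] PD(1)[of v] v by (auto simp: P_def)
  have p_only: "p \<notin> grid_points (P u)" if "u \<in> verts G - X" "u \<noteq> v" for u
    using p(2)[of "P' u"] PD(1)[of u] PD(2)[of v u] that v by (simp add: P_def)
  have p_in: "p \<in> grid_points (P v)" and p_not_end: "p \<notin> ends (P v)"
    using p(1) by (cases "P v"; auto)+
  obtain N where N: "star (P v) p 0 2 N"
    using star_at_interior_point[OF p(1)] by blast
  obtain f where f: "inj_on f X" "f ` X \<subseteq> {..<2 :: nat}"
    using card_le_inj[OF finX, of "{..<2 :: nat}"] X by auto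
  have "r u \<le> card (free_ends ?G P u - {p})" if u: "u \<in> verts G - X" for u
  proof -
    have "positive_length (P u)"
      using contact_B0_VPG_repD(1)[OF P, of u] u by simp
    then have "p \<notin> free_ends ?G P u"
      using p_only[OF u] p_not_end ends_subset_grid_points[of "P u"] by (auto simp: free_ends_def)
    then show ?thesis
      using free[OF u] by simp
  qed
  then show ?thesis
    using representable_attach_leaf_block[OF G leaf P p_in p_only N f] free_X by simp
qed

text \<open>Each situation in which a leaf block cannot be attached is itself an obstruction: a K4
  with demand 2 in \<open>X\<close>, or two adjacent vertices with demand 2. In all others, a
  representation as well as an obstruction of the smaller graph extends.\<close>

theorem representable_or_obstructed:
  assumes "simple_graph G" "chordal G" "\<not> has_induced G K4_minus" "\<not> has_induced G (complete_graph 5)"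
  shows "representable G r \<or> obstructed G r"
  using assms
proof (induction "card (verts G)" arbitrary: G r rule: less_induct)
  case less
  note G = less.prems(1)
  have IH: "representable (induced_subgraph G (verts G - X)) s \<or> obstructed (induced_subgraph G (verts G - X)) s"
    if "X \<subseteq> verts G" "X \<noteq> {}" for X s
  proof (rule less.hyps)
    have "verts G \<inter> (verts G - X) \<subset> verts G"
      using that by blast
    then show "card (verts (induced_subgraph G (verts G - X))) < card (verts G)"
      using G by (simp add: psubset_card_mono)
  qed (use less.prems has_induced_subgraph chordal_induced_subgraph simple_induced_subgraph in blast)+
  consider "verts G = {}" | x where "x \<in> verts G" "r x \<ge> 3"
    | x where "x \<in> verts G" "\<And>u v. \<not> adj G u v" "r x \<le> 2"
    | a b where "adj G a b" "\<And>x. x \<in> verts G \<Longrightarrow> r x \<le> 2"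
  proof (cases "(\<exists>x \<in> verts G. r x \<ge> 3) \<or> verts G = {}")
    case True
    then show thesis
      using that(1,2) by blast
  next
    case False
    then obtain x where x: "x \<in> verts G" and r2: "\<And>y. y \<in> verts G \<Longrightarrow> r y \<le> 2"
      by fastforce
    show thesis
    proof (cases "\<exists>a b. adj G a b")
      case True
      then show thesis
        using that(4) r2 by blast
    next
      case False
      then show thesis
        using that(3)[OF x] r2[OF x] by blast
    qed
  qed
  then show ?case
  proof cases
    case 1
    then have "representable G r"
      unfolding representable_def contact_B0_VPG_rep_iff by simp
    then show ?thesis ..
  next
    case 2
    then show ?thesis
      using obstructed_demand_3[OF G] by blast
  next
    case 3
    then show ?thesis
      using representable_isolated[OF G, of x r] obstructed_induced_subgraph IH[of "{x}" r] by blast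
  next
    case 4
    obtain v X where leaf: "leaf_block G v X"
      using leaf_block_exists[OF G less.prems(2,3) 4(1)] unfolding leaf_block_def by metis
    have lf: "v \<in> verts G" "X \<noteq> {}" "X \<subseteq> verts G" "v \<notin> X" "clique (insert v X) (edges G)"
      using leaf unfolding leaf_block_def by blast+
    have finX: "finite X"
      using lf(3) G by (auto intro: finite_subset)
    have "card (insert v X) < 5"
      using lf by (intro K5_free_clique_card[OF less.prems(4) G]) auto
    then have card_X: "card X \<le> 3"
      using finX lf(4) by simp
    have r2: "r x \<le> 2" if "x \<in> X" for x
      using 4(2) lf(3) that by blast
    note IH = IH[OF lf(3,2)]
    show ?thesis
    proof (cases "card X = 3")
      case True
      show ?thesis
      \<comment> \<open>All four paths of a K4 end at the common point, so each vertex of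
        \<open>X\<close> keeps at most one free end.\<close>
      proof (cases "\<exists>x \<in> X. r x \<ge> 2")
        case True
        then show ?thesis
          using obstructed_K4[OF G leaf \<open>card X = 3\<close>] by blast
      next
        case False
        obtain f where f: "inj_on f X" "f ` X \<subseteq> {..<3 :: nat}"
          using card_le_inj[OF finX, of "{..<3 :: nat}"] card_X by auto
        have "representable G r" if "representable (induced_subgraph G (verts G - X)) (r(v := Suc (r v)))"
          using star_at_end(1) f False that
          by (intro representable_leaf_end[OF G leaf, of 0 3 f]) (auto simp: not_le)
        then show ?thesis
          using IH[of "r(v := Suc (r v))"] obstructed_via_K4[OF G leaf True] by blast
      qed
    next
      case False
      then have card2: "card X \<le> 2"
        using card_X by simp
      show ?thesis
      proof (cases "\<exists>x \<in> X. r x \<ge> 2")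
        case False
        then have "r x \<le> 1" if "x \<in> X" for x
          using that by fastforce
        then show ?thesis
          using IH[of r] representable_leaf_interior[OF G leaf card2] obstructed_induced_subgraph by blast
      next
        case True
        then obtain x where x: "x \<in> X" "r x \<ge> 2"
          by blast
        show ?thesis
        proof (cases "\<exists>y \<in> X - {x}. r y \<ge> 2")
          case True
          then obtain y where y: "y \<in> X" "y \<noteq> x" "r y \<ge> 2"
            by blast
          then have "adj G x y"
            using leaf_block_adj[OF leaf] x(1) by simp
          then show ?thesis
            using obstructed_edge[OF G] x y by blast
        next
          case False
          \<comment> \<open>\<open>x\<close> gets position 0, the path that passes through the
            contact point; the other vertex of \<open>X\<close>, if there is one, gets position
            1.\<close>
          define f where "f y = (if y = x then 0 else 1 :: nat)" for y
          have "y = z" if "y \<in> X - {x}" "z \<in> X - {x}" for y z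
          proof (rule ccontr)
            assume "y \<noteq> z"
            then have "card {x, y, z} = 3"
              using that by auto
            then show False
              using card_mono[OF finX, of "{x, y, z}"] card2 that x(1) by simp
          qed
          then have f: "inj_on f X" "f ` X \<subseteq> {..<2}"
            by (auto simp: f_def inj_on_def)
          have free: "r y \<le> (if f y < 1 then 2 else 1)" if "y \<in> X" for y
            using False that r2[OF that] by (auto simp: f_def not_le less_Suc_eq_le numeral_2_eq_2)
          have "representable G r" if "representable (induced_subgraph G (verts G - X)) (r(v := Suc (r v)))"
            using representable_leaf_end[OF G leaf star_at_end(2) f free that] .
          then show ?thesis
            using IH[of "r(v := Suc (r v))"] obstructed_via_edge[where r = r, OF G leaf x] by blast
        qed
      qed
    qed
  qed
qed

section \<open>Obstructions as induced subgraphs\<close>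

text \<open>\<open>family_T\<close> consists of graphs on natural numbers. In a copy of this type,
  the subgraph induced by an obstruction can be a member of the family itself.\<close>

lemma nat_copy:
  assumes G: "simple_graph G"
  obtains G' :: "nat graph" where "simple_graph G'" "has_induced G G'" "has_induced G' G"
proof -
  obtain h :: "'a \<Rightarrow> nat" where h: "inj_on h (verts G)"
    using G finite_imp_inj_to_nat_seg[of "verts G"] by auto
  define G' where "G' = Graph (h ` verts G) {{h u, h v} | u v. adj G u v}"
  have V: "verts G' = h ` verts G"
    by (simp add: G'_def)
  have h_eq: "h u = h v \<longleftrightarrow> u = v" if "u \<in> verts G" "v \<in> verts G" for u v
    using h that by (auto simp: inj_on_def)
  have edge: "adj G' a b \<longleftrightarrow> (\<exists>u v. adj G u v \<and> a = h u \<and> b = h v)" for a b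
    using adj_sym[of G] by (auto simp: G'_def adj_def[of "Graph _ _"] doubleton_eq_iff)
  have adj: "adj G' (h u) (h v) \<longleftrightarrow> adj G u v" if "u \<in> verts G" "v \<in> verts G" for u v
    using that h_eq simple_graphD(1,2)[OF G] unfolding edge by metis
  have "{h u, h v} \<in> [h ` verts G]\<^bsup>2\<^esup>" if "adj G u v" for u v
    using simple_graphD[OF G that] h_eq by (auto simp: nsets_2_eq)
  then have "simple_graph G'"
    using G by (auto simp: simple_graph_def G'_def)
  moreover have "has_induced G' G"
    unfolding has_induced_iff V using h adj by (intro exI[of _ h]) simp
  moreover have "has_induced G G'"
    unfolding has_induced_iff V using h adj
    by (intro exI[of _ "inv_into (verts G) h"]) (simp add: inj_on_inv_into)
  ultimately show thesis
    using that by blast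
qed

text \<open>The only tree vertex has degree 0 and \<open>\<rho> t = 0\<close>, so triangles account
  for the whole sum 3.\<close>

lemma has_induced_H0:
  assumes G: "simple_graph G" and obs: "obstruction G (\<lambda>_. 0) {t} \<D> \<rho>"
  shows "has_induced G H0"
proof -
  note ob = obstructionD[OF obs]
  have "{u \<in> {t}. adj G t u} = {}"
    using simple_graphD(3)[OF G] by auto
  then have "degree (induced_subgraph G {t}) t = 0"
    using ob(1) by (simp add: degree_induced_subgraph)
  moreover have "\<rho> t = 0"
    using ob(8) by simp
  moreover have comp: "complete_to G {t} D" "t \<notin> D" if "D \<in> \<D>" for D
    using ob(3,7) that adj_sym[of G] by (auto simp: complete_to_def)
  then have "{D \<in> \<D>. complete_to G {t} D} = \<D>"
    by blast
  ultimately have "card \<D> = 3"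
    using ob(8) by simp
  then obtain A B C where ABC: "\<D> = {A, B, C}" "A \<noteq> B" "A \<noteq> C" "B \<noteq> C"
    by (metis card_3_iff)
  have card: "card A = 3" "card B = 3" "card C = 3"
    using ob(5) ABC(1) by auto
  have fin: "finite A" "finite B" "finite C"
    using card by (metis card.infinite zero_neq_numeral)+
  obtain a where a: "bij_betw a {1, 2, 3 :: nat} A"
    using finite_same_card_bij[of "{1, 2, 3 :: nat}" A] card fin by auto
  obtain b where b: "bij_betw b {4, 5, 6 :: nat} B"
    using finite_same_card_bij[of "{4, 5, 6 :: nat}" B] card fin by auto
  obtain c where c: "bij_betw c {7, 8, 9 :: nat} C"
    using finite_same_card_bij[of "{7, 8, 9 :: nat}" C] card fin by auto
  define g where "g i = (if i = 0 then t else if i \<le> 3 then a i else if i \<le> 6 then b i else c i)" for i :: nat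
  have V: "verts H0 = {0, 1, 2, 3, 4, 5, 6, 7, 8, 9}"
    by (auto simp: H0_def)
  have ga: "g ` {1, 2, 3} = A" and gb: "g ` {4, 5, 6} = B" and gc: "g ` {7, 8, 9} = C" and g0: "g 0 = t"
    using a b c by (auto simp: g_def bij_betw_def)
  have V': "verts H0 = {0} \<union> {1, 2, 3} \<union> {4, 5, 6} \<union> {7, 8, 9}"
    unfolding V by auto
  have disj: "A \<inter> B = {}" "A \<inter> C = {}" "B \<inter> C = {}" "t \<notin> A" "t \<notin> B" "t \<notin> C"
    using ob(6) comp(2) ABC by auto
  have image: "g ` verts H0 = insert t (A \<union> B \<union> C)"
    unfolding V' image_Un ga gb gc by (simp add: g0)
  \<comment> \<open>Injectivity by counting: the image has 1 + 3 + 3 + 3 elements.\<close>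
  have "card (g ` verts H0) = 10"
    unfolding image using disj card fin by (simp add: card_Un_disjoint Int_Un_distrib2)
  then have inj: "inj_on g (verts H0)"
    by (intro eq_card_imp_inj_on) (simp_all add: V)
  have mem: "g i \<in> insert t (g ` I) \<longleftrightarrow> i \<in> insert 0 I" if "i \<in> verts H0" "I \<subseteq> verts H0" for i I
  proof -
    have "insert t (g ` I) = g ` insert 0 I"
      by (simp add: g0)
    moreover have "insert 0 I \<subseteq> verts H0"
      using that(2) by (simp add: V)
    ultimately show ?thesis
      using inj_on_image_mem_iff[OF inj that(1)] by metis
  qed
  have adj_t: "adj G t x" "adj G x t" if "x \<in> A \<union> B \<union> C" for x
  proof -
    have "complete_to G {t} A" "complete_to G {t} B" "complete_to G {t} C"
      using comp(1) by (simp_all add: ABC)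
    then show "adj G t x"
      using that by (auto simp: complete_to_def)
    then show "adj G x t"
      by (simp add: adj_sym[of G x t])
  qed
  have adj_in: "adj G x y" if "x \<in> D" "y \<in> D" "x \<noteq> y" "D \<in> \<D>" for x y D
    using ob(5) that unfolding clique_adj by blast
  have adj_out: "\<not> adj G x y" if "x \<in> D" "y \<in> D'" "D \<noteq> D'" "D \<in> \<D>" "D' \<in> \<D>" for x y D D'
    using ob(6) that unfolding anticomplete_to_def by blast
  \<comment> \<open>Adjacency is restated as lying in a common K4 \<open>insert t D\<close>, to
    match the shape of \<open>adj_H0\<close>.\<close>
  have adj_G: "adj G x y \<longleftrightarrow> x \<noteq> y \<and> (\<exists>D \<in> \<D>. x \<in> insert t D \<and> y \<in> insert t D)"
    if xy: "x \<in> insert t (A \<union> B \<union> C)" "y \<in> insert t (A \<union> B \<union> C)" for x y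
  proof -
    have un: "A \<union> B \<union> C = \<Union>\<D>"
      by (auto simp: ABC)
    have irr: "\<not> adj G x x"
      using simple_graphD(3)[OF G] by blast
    show ?thesis
    proof (cases "x = t \<or> y = t")
      case True
      then show ?thesis
        using xy adj_t irr unfolding un by auto
    next
      case False
      then obtain D D' where D: "D \<in> \<D>" "x \<in> D" "D' \<in> \<D>" "y \<in> D'"
        using xy unfolding un by blast
      have unique: "E = D" if "E \<in> \<D>" "x \<in> E" for E
        using ob(6) D that by blast
      have unique': "E = D'" if "E \<in> \<D>" "y \<in> E" for E
        using ob(6) D that by blast
      show ?thesis
        using False D unique unique' adj_in[of x D y] adj_out[of x D y D'] irr by blast
    qed
  qed
  have "adj H0 i j \<longleftrightarrow> adj G (g i) (g j)" if "i \<in> verts H0" "j \<in> verts H0" for i j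
  proof -
    have "{1, 2, 3} \<subseteq> verts H0" "{4, 5, 6} \<subseteq> verts H0" "{7, 8, 9} \<subseteq> verts H0"
      by (auto simp: V)
    note mems = mem[OF _ this(1), unfolded ga] mem[OF _ this(2), unfolded gb] mem[OF _ this(3), unfolded gc]
    have "g i \<in> insert t (A \<union> B \<union> C)" "g j \<in> insert t (A \<union> B \<union> C)"
      using that image by blast+
    then have "adj G (g i) (g j) \<longleftrightarrow> i \<noteq> j \<and> (\<exists>D \<in> {A, B, C}. g i \<in> insert t D \<and> g j \<in> insert t D)"
      using adj_G inj that by (simp only: ABC inj_on_eq_iff)
    then show ?thesis
      by (simp only: adj_H0 bex_simps mems[OF that(1)] mems[OF that(2)])
  qed
  moreover have "g ` verts H0 \<subseteq> verts G"
    unfolding image using ob(1,2) ABC by auto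
  ultimately show ?thesis
    using inj unfolding has_induced_iff by blast
qed

text \<open>Demand 0 forces \<open>\<rho>\<close> to vanish on \<open>T\<close>, so the number of
  triangles at a tree vertex is 3 minus its degree, as the family prescribes.\<close>

lemma tree_with_triangles_if_obstruction:
  assumes G: "simple_graph G" and obs: "obstruction G (\<lambda>_. 0) T \<D> \<rho>" and T: "card T \<ge> 2"
  shows "tree_with_triangles (induced_subgraph G (T \<union> \<Union>\<D>))"
proof -
  let ?H = "induced_subgraph G (T \<union> \<Union>\<D>)"
  note ob = obstructionD[OF obs]
  have V: "verts ?H = T \<union> \<Union>\<D>"
    using ob(1,2) by auto
  have ind: "induced_subgraph ?H T = induced_subgraph G T"
    by (simp add: Int_absorb1)
  have comp: "complete_to ?H {v} D = complete_to G {v} D" "complete_to ?H D {v} = complete_to G D {v}"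
    if "v \<in> T" "D \<in> \<D>" for v D
    using that by (auto simp: complete_to_def)
  have anti: "anticomplete_to ?H A B \<longleftrightarrow> anticomplete_to G A B" if "A \<subseteq> T \<union> \<Union>\<D>" "B \<subseteq> T \<union> \<Union>\<D>" for A B
    using that by (auto simp: anticomplete_to_def subset_iff)
  have set: "{D \<in> \<D>. complete_to ?H {v} D} = {D \<in> \<D>. complete_to G {v} D}" if "v \<in> T" for v
    using comp(1)[OF that] by blast
  have deg: "degree (induced_subgraph G T) v + card {D \<in> \<D>. complete_to G {v} D} = 3" if "v \<in> T" for v
    using bspec[OF ob(8) that] by simp
  have clique: "\<forall>D \<in> \<D>. card D = 3 \<and> clique D (edges ?H)"
    using ob(5) by (auto simp: clique_adj)
  have DS: "D \<subseteq> T \<union> \<Union>\<D>" if "D \<in> \<D>" for D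
    using that by blast
  have TS: "T - {v} \<subseteq> T \<union> \<Union>\<D>" for v
    by blast
  have pairs: "\<forall>D \<in> \<D>. \<forall>D' \<in> \<D>. D \<noteq> D' \<longrightarrow> D \<inter> D' = {} \<and> anticomplete_to ?H D D'"
    using ob(6) anti[OF DS DS] by simp
  have triangles: "\<forall>D \<in> \<D>. \<exists>v \<in> T. complete_to ?H D {v} \<and> anticomplete_to ?H D (T - {v})"
    using ob(7) comp(2) anti[OF DS TS] by simp
  \<comment> \<open>A triangle sees only one tree vertex and is complete to it, so a neighbour of
    \<open>v\<close> in a triangle would make that triangle count at \<open>v\<close>; degree 3
    leaves no room for it.\<close>
  have deg3: "anticomplete_to ?H {v} (verts ?H - T)" if v: "v \<in> T" and d: "degree (induced_subgraph G T) v = 3" for v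
  proof -
    have "finite {D \<in> \<D>. complete_to G {v} D}"
      using obstruction_finite_triangles[OF G obs] by simp
    then have none: "\<not> complete_to G {v} D" if "D \<in> \<D>" for D
      using deg[OF v] d that by auto
    have "\<not> adj G v x" if x: "x \<in> D" and D: "D \<in> \<D>" for x D
    proof -
      obtain w where w: "w \<in> T" "complete_to G D {w}" "anticomplete_to G D (T - {w})"
        using ob(7) D by blast
      then have "w \<noteq> v"
        using none[OF D] adj_sym[of G] by (auto simp: complete_to_def)
      then show ?thesis
        using w(3) v x adj_sym[of G] by (auto simp: anticomplete_to_def)
    qed
    then show ?thesis
      using V ob(3) unfolding anticomplete_to_def by auto
  qed
  show ?thesis
    unfolding tree_with_triangles_def
  proof (intro conjI exI[of _ T] exI[of _ \<D>] ballI impI)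
    fix v assume v: "v \<in> T"
    show "degree (induced_subgraph ?H T) v \<le> 3"
      using deg[OF v] by (simp only: ind)
    show "card {D \<in> \<D>. complete_to ?H {v} D} = 2" if "degree (induced_subgraph ?H T) v = 1"
      using deg[OF v] that by (simp only: ind set[OF v])
    show "card {D \<in> \<D>. complete_to ?H {v} D} = 1" if "degree (induced_subgraph ?H T) v = 2"
      using deg[OF v] that by (simp only: ind set[OF v])
    show "anticomplete_to ?H {v} (verts ?H - T)" if "degree (induced_subgraph ?H T) v = 3"
      using deg3[OF v] that by (simp only: ind)
  qed (use V ob T clique pairs triangles ind simple_induced_subgraph[OF G] in auto)
qed

lemma family_T_if_obstructed:
  assumes G: "simple_graph (G :: nat graph)" and "obstructed G (\<lambda>_. 0)"
  shows "\<exists>H \<in> family_T. has_induced G H"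
proof -
  obtain T \<D> \<rho> where obs: "obstruction G (\<lambda>_. 0) T \<D> \<rho>"
    using assms(2) unfolding obstructed_def by blast
  have "T \<noteq> {}" "finite T"
    using obstructionD(1,4)[OF obs] G by (auto simp: is_tree_def connected_graph_def intro: finite_subset)
  then have "card T = 1 \<or> card T \<ge> 2"
    by (metis One_nat_def Suc_leI card_gt_0_iff le_neq_implies_less numeral_2_eq_2)
  then show ?thesis
  proof
    assume "card T = 1"
    then obtain t where "T = {t}"
      by (rule card_1_singletonE)
    then have "has_induced G H0"
      using has_induced_H0[OF G] obs by blast
    then show ?thesis
      unfolding family_T_def by blast
  next
    assume "card T \<ge> 2"
    then show ?thesis
      using tree_with_triangles_if_obstruction[OF G obs] has_induced_induced_subgraph
      unfolding family_T_def by blast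
  qed
qed

lemma family_T_not_contact:
  assumes "H \<in> family_T"
  shows "\<not> contact_B0_VPG H"
  using assms obstructed_not_contact simple_H0 obstructed_H0 tree_with_triangles_obstructed
  unfolding family_T_def by blast

theorem theorem13:
  fixes G :: "'a graph"
  assumes "simple_graph G"
    and "chordal G"
  shows "contact_B0_VPG G \<longleftrightarrow> free_of (family_T \<union> {complete_graph 5, K4_minus}) G"
proof
  assume "contact_B0_VPG G"
  then show "free_of (family_T \<union> {complete_graph 5, K4_minus}) G"
    unfolding free_of_def
    using contact_B0_VPG_has_induced family_T_not_contact not_contact_K5 not_contact_K4_minus by blast
next
  assume free: "free_of (family_T \<union> {complete_graph 5, K4_minus}) G"
  obtain G' :: "nat graph" where G': "simple_graph G'" "has_induced G G'" "has_induced G' G"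
    using nat_copy[OF assms(1)] by blast
  have inherit: "\<not> has_induced G' H" if "\<not> has_induced G H" for H :: "nat graph"
    using that has_induced_trans[OF G'(2)] by blast
  have "chordal G'"
    using assms(2) inherit unfolding chordal_def by blast
  then have "representable G' (\<lambda>_. 0) \<or> obstructed G' (\<lambda>_. 0)"
    using G'(1) inherit free by (intro representable_or_obstructed) (auto simp: free_of_def)
  moreover have "\<not> obstructed G' (\<lambda>_. 0)"
    using family_T_if_obstructed[OF G'(1)] inherit free unfolding free_of_def by blast
  ultimately have "contact_B0_VPG G'"
    unfolding representable_def contact_B0_VPG_def by blast
  then show "contact_B0_VPG G"
    by (rule contact_B0_VPG_has_induced[OF G'(3)])
qed

end
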